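(* Let $\tau \colon \mathcal A^* \to \mathcal A^*$ be a primitive substitution and suppose that $X_\tau$ has an irrational eigenvalue $\alpha$. Then there exist a primitive substitution $\sigma \colon \mathcal B^* \to \mathcal B^*$ generating a subshift $X_\sigma$ conjugate to $X_\tau$ and a letter $a \in \mathcal B$ such that $\alpha |\sigma^n(a)|$ stays bounded away from $\mathbb Z$ as $n \to \infty$. In particular, if $n \geq 0$ and $c_n$ is any letter-coboundary in $X_\sigma$ such that $$\sup\big\{ \| c_n(\sigma^{m-n}(u)) - \alpha\,|\sigma^m(u)| \| : u\in\mathcal L(X_\sigma)\big\}$$ converges to $0$ as $m\to\infty$, then $c_n$ is nontrivial.
   Context: A substitution $\tau$ on a finite alphabet $\mathcal A$ (with at least two letters) is a monoid morphism $\tau:\mathcal A^*\to\mathcal A^*$ of the free monoid such that each $\tau(a)$, $a\in\mathcal A$, is non-empty and each letter occurs in some $\tau(a)$; it is primitive if some power of its incidence matrix (whose $(b,a)$ entry is the number of occurrences of $b$ in $\tau(a)$) has only positive entries. $X_\tau\subseteq\mathcal A^{\mathbb Z}$ is the subshift of all $x$ such that every finite factor of $x$ occurs in $\tau^n(a)$ for some $n\ge1$, $a\in\mathcal A$. $S$ is the shift map. $\mathcal L(X)$ is the set of finite words occurring in points of $X$. Subshifts $X,Y$ are conjugate if there is a homeomorphism $X\to Y$ commuting with the shift. A real number $\alpha$ is an eigenvalue (continuous additive) of $X$ if there is a continuous $g:X\to\mathbb R/\mathbb Z$ with $g(Sx)=g(x)+\alpha\pmod{\mathbb Z}$ for all $x\in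 X$. For $x\in\mathbb R$, $\|x\|$ is the distance from $x$ to the nearest integer. A return word to a letter $b$ in a subshift $X\subseteq\mathcal B^{\mathbb Z}$ is a word $w$ such that $wb\in\mathcal L(X)$ and $wb$ contains exactly two occurrences of $b$, one as a prefix and one as a suffix. A letter-coboundary in $X$ is a monoid morphism $c:\mathcal B^*\to(\mathbb R,+)$ such that $c(w)=0$ for every letter $b$ and every return word $w$ to $b$ in $X$; it is trivial if $c(b)=0$ for all $b\in\mathcal B$. *)

theory Defs
  imports "HOL-Analysis.Analysis" "HOL-Library.Sublist"
begin

text \<open>
  Alphabets are finite sets of letters, and the free monoid over \<open>A\<close> is \<open>lists A\<close>. All maps on words
  and on points of \<open>A\<close>-valued subshifts are only constrained on these carriers.
\<close>

definition free_monoid_endo :: "'a set \<Rightarrow> ('a list \<Rightarrow> 'a list) \<Rightarrow> bool" where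
  "free_monoid_endo A \<tau> \<longleftrightarrow> \<tau> \<in> lists A \<rightarrow> lists A \<and> \<tau> [] = [] \<and>
     (\<forall>u\<in>lists A. \<forall>v\<in>lists A. \<tau> (u @ v) = \<tau> u @ \<tau> v)"

definition substitution :: "'a set \<Rightarrow> ('a list \<Rightarrow> 'a list) \<Rightarrow> bool" where
  "substitution A \<tau> \<longleftrightarrow> finite A \<and> 2 \<le> card A \<and> free_monoid_endo A \<tau> \<and>
     (\<forall>a\<in>A. \<tau> [a] \<noteq> []) \<and> (\<forall>b\<in>A. \<exists>a\<in>A. b \<in> set (\<tau> [a]))"

definition incidence_matrix :: "('a list \<Rightarrow> 'a list) \<Rightarrow> 'a \<Rightarrow> 'a \<Rightarrow> nat" where
  "incidence_matrix \<tau> b a = count_list (\<tau> [a]) b"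

text \<open>Powers of a square matrix whose rows and columns are indexed by the set \<open>A\<close>.\<close>

primrec matrix_power :: "'a set \<Rightarrow> ('a \<Rightarrow> 'a \<Rightarrow> nat) \<Rightarrow> nat \<Rightarrow> 'a \<Rightarrow> 'a \<Rightarrow> nat" where
  "matrix_power A M 0 = (\<lambda>b a. if b = a then 1 else 0)"
| "matrix_power A M (Suc k) = (\<lambda>b a. \<Sum>c\<in>A. M b c * matrix_power A M k c a)"

definition primitive_substitution :: "'a set \<Rightarrow> ('a list \<Rightarrow> 'a list) \<Rightarrow> bool" where
  "primitive_substitution A \<tau> \<longleftrightarrow> substitution A \<tau> \<and>
     (\<exists>k\<ge>1. \<forall>b\<in>A. \<forall>a\<in>A. matrix_power A (incidence_matrix \<tau>) k b a > 0)"

definition shift :: "(int \<Rightarrow> 'a) \<Rightarrow> int \<Rightarrow> 'a" where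
  "shift x = (\<lambda>i. x (i + 1))"

text \<open>The factors of a point \<open>x\<close> are the words \<open>map x [i..j]\<close>; the empty word arises for \<open>j < i\<close>.\<close>

definition subst_subshift :: "'a set \<Rightarrow> ('a list \<Rightarrow> 'a list) \<Rightarrow> (int \<Rightarrow> 'a) set" where
  "subst_subshift A \<tau> = {x \<in> UNIV \<rightarrow> A.
     \<forall>i j. \<exists>n\<ge>1. \<exists>a\<in>A. sublist (map x [i..j]) ((\<tau> ^^ n) [a])}"

definition language :: "(int \<Rightarrow> 'a) set \<Rightarrow> 'a list set" where
  "language X = {map x [i..j] | x i j. x \<in> X}"

definition subshift_topology :: "'a set \<Rightarrow> (int \<Rightarrow> 'a) set \<Rightarrow> (int \<Rightarrow> 'a) topology" where
  "subshift_topology A X = subtopology (product_topology (\<lambda>_. discrete_topology A) UNIV) X"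

definition conjugate_subshifts ::
  "'a set \<Rightarrow> (int \<Rightarrow> 'a) set \<Rightarrow> 'b set \<Rightarrow> (int \<Rightarrow> 'b) set \<Rightarrow> bool" where
  "conjugate_subshifts A X B Y \<longleftrightarrow>
     (\<exists>f. homeomorphic_map (subshift_topology A X) (subshift_topology B Y) f \<and>
          (\<forall>x\<in>X. f (shift x) = shift (f x)))"

text \<open>
  \<open>\<real>/\<int>\<close> is the set of cosets \<open>t +o \<int>\<close> with the quotient topology. The lemma \<open>quotient_map_reals_mod_ints\<close>
  below confirms that the predicate passed to \<open>topology\<close> is a topology and yields the quotient.
\<close>

definition reals_mod_ints :: "real set topology" where
  "reals_mod_ints =
     topology (\<lambda>U. U \<subseteq> range (\<lambda>t. t +o \<int>) \<and> open ((\<lambda>t. t +o \<int>) -` U))"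

lemma openin_reals_mod_ints:
  "openin reals_mod_ints U \<longleftrightarrow> U \<subseteq> range (\<lambda>t. t +o \<int>) \<and> open ((\<lambda>t. t +o \<int>) -` U)"
proof -
  have "istopology (\<lambda>U :: real set set.
          U \<subseteq> range (\<lambda>t. t +o \<int>) \<and> open ((\<lambda>t. t +o \<int>) -` U))"
    unfolding istopology_def by (auto simp: vimage_Union)
  then show ?thesis
    by (simp add: reals_mod_ints_def topology_inverse')
qed

lemma topspace_reals_mod_ints: "topspace reals_mod_ints = range (\<lambda>t. t +o \<int>)"
proof (rule antisym)
  show "range (\<lambda>t. t +o \<int>) \<subseteq> topspace reals_mod_ints"
    by (rule openin_subset) (simp add: openin_reals_mod_ints vimage_def)
  show "topspace reals_mod_ints \<subseteq> range (\<lambda>t. t +o \<int>)"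
    using openin_reals_mod_ints openin_topspace by blast
qed

lemma quotient_map_reals_mod_ints:
  "quotient_map euclidean reals_mod_ints (\<lambda>t. t +o \<int>)"
  by (auto simp: quotient_map_def topspace_reals_mod_ints openin_reals_mod_ints vimage_def)

text \<open>Since \<open>g x\<close> is a coset of \<open>\<int>\<close>, the translate \<open>\<alpha> +o g x\<close> is \<open>g x + \<alpha>\<close> in \<open>\<real>/\<int>\<close>.\<close>

definition eigenvalue :: "'a set \<Rightarrow> (int \<Rightarrow> 'a) set \<Rightarrow> real \<Rightarrow> bool" where
  "eigenvalue A X \<alpha> \<longleftrightarrow>
     (\<exists>g. continuous_map (subshift_topology A X) reals_mod_ints g \<and>
          (\<forall>x\<in>X. g (shift x) = \<alpha> +o g x))"

abbreviation dist_int :: "real \<Rightarrow> real" where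
  "dist_int t \<equiv> infdist t \<int>"

definition return_word :: "(int \<Rightarrow> 'a) set \<Rightarrow> 'a \<Rightarrow> 'a list \<Rightarrow> bool" where
  "return_word X b w \<longleftrightarrow> w @ [b] \<in> language X \<and> count_list (w @ [b]) b = 2 \<and>
     prefix [b] (w @ [b]) \<and> suffix [b] (w @ [b])"

definition letter_coboundary :: "'a set \<Rightarrow> (int \<Rightarrow> 'a) set \<Rightarrow> ('a list \<Rightarrow> real) \<Rightarrow> bool" where
  "letter_coboundary B X c \<longleftrightarrow> c [] = 0 \<and>
     (\<forall>u\<in>lists B. \<forall>v\<in>lists B. c (u @ v) = c u + c v) \<and>
     (\<forall>b\<in>B. \<forall>w. return_word X b w \<longrightarrow> c w = 0)"

definition trivial_coboundary :: "'a set \<Rightarrow> ('a list \<Rightarrow> real) \<Rightarrow> bool" where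
  "trivial_coboundary B c \<longleftrightarrow> (\<forall>b\<in>B. c [b] = 0)"

end

theory Submission
  imports Defs
begin

text \<open>
  The lengths \<open>\<bar>\<tau>\<^sup>n(u)\<bar>\<close>, scaled by \<open>\<alpha>\<close> and read modulo 1, are governed by the eigenfunction \<open>g\<close>:
  if a point carries the word \<open>\<tau>\<^sup>n(u)\<close> between two cuts, then \<open>\<alpha> \<bar>\<tau>\<^sup>n(u)\<bar>\<close> is the difference of the
  values of \<open>g\<close> at these cuts. After passing to a power of \<open>\<tau>\<close>, the first and the last letter of
  \<open>\<tau>\<^sup>n(b)\<close> do not depend on \<open>n \<ge> 1\<close>, so the surroundings of the two cuts stabilise as \<open>n\<close> grows, and
  uniform continuity of \<open>g\<close> makes \<open>\<alpha> \<bar>\<tau>\<^sup>n(u)\<bar>\<close> modulo 1 a Cauchy sequence, uniformly over all factors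
  \<open>u\<close> (\<open>scaled_lengths_uniformly_Cauchy\<close>). Hence either some letter already has scaled lengths
  bounded away from the integers, or \<open>\<alpha> \<bar>\<tau>\<^sup>n(u)\<bar>\<close> tends to 0 modulo 1 uniformly in \<open>u\<close>
  (\<open>bounded_away_or_uniformly_null\<close>).

  In the second case the cuts have to be moved. Let \<open>T\<close> be a high power of \<open>\<tau>\<close> and choose for each
  letter \<open>b\<close> a shift \<open>s b \<le> \<bar>T(b)\<bar> - 2\<close>. The cut in front of a letter \<open>b\<close> is sent not to the beginning of
  \<open>T(b)\<close> but \<open>s b\<close> letters further. The image of a letter then depends on that letter and its right
  neighbour, so this defines a substitution \<open>\<sigma>\<close> on the factors \<open>bc\<close> of length two, and \<open>X\<^sub>\<sigma>\<close> is the
  two-block presentation of \<open>X\<^sub>\<tau>\<close>, whatever the shifts are (\<open>prim_subst_sigma\<close>, \<open>conjugate_sigma\<close>).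
  Writing \<open>\<phi>(b)\<close> for the letter of \<open>T(b)\<close> at position \<open>s b\<close>, one has
  \<open>\<bar>\<sigma>\<^bsup>n+1\<^esup>(bc)\<bar> = \<bar>T(u)\<bar> + s(\<phi>\<^sup>n(c)) - s(\<phi>\<^sup>n(b))\<close> for some factor \<open>u\<close>. The term \<open>\<alpha> \<bar>T(u)\<bar>\<close> is negligible
  modulo 1 because the convergence to 0 is uniform, so that no accumulation of errors over \<open>n\<close> has to
  be controlled.

  It remains to choose \<open>s\<close> with values in \<open>{0, k}\<close> such that \<open>\<phi>\<^sup>n(b)\<close> and \<open>\<phi>\<^sup>n(c)\<close> eventually have
  different shifts for some factor \<open>bc\<close>; as \<open>\<alpha>\<close> is irrational, \<open>\<alpha> k\<close> is not an integer. Take a letter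
  \<open>p\<close> such that \<open>T(p)\<close> begins with \<open>p\<close>, another letter \<open>q\<close>, and a position \<open>k \<ge> 1\<close> at which \<open>q\<close> occurs
  in \<open>T(q)\<close>; \<open>k\<close> can be fixed before the power \<open>T\<close> because the prefixes of \<open>\<tau>\<^sup>n(q)\<close> are stable. With
  \<open>s q = k\<close> and \<open>s = 0\<close> elsewhere, both \<open>p\<close> and \<open>q\<close> are fixed by \<open>\<phi>\<close>, and somewhere on the way from an
  occurrence of \<open>p\<close> to one of \<open>q\<close> there is a factor \<open>bc\<close> exactly one letter of which is absorbed by \<open>q\<close>
  (\<open>sigma_bounded_away_of_shift\<close>).

  The statement on coboundaries follows: for the trivial coboundary, the supremum is at least the
  distance of \<open>\<alpha> \<bar>\<sigma>\<^sup>m(a)\<bar>\<close> to the integers.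
\<close>

section \<open>Primitive substitutions and their factors\<close>

definition factors :: "'a set \<Rightarrow> ('a list \<Rightarrow> 'a list) \<Rightarrow> 'a list set" where
  "factors A \<tau> = {w. \<exists>n\<ge>1. \<exists>a\<in>A. sublist w ((\<tau> ^^ n) [a])}"

lemma subst_subshift_iff_factors:
  "x \<in> subst_subshift A \<tau> \<longleftrightarrow> range x \<subseteq> A \<and> (\<forall>i j. map x [i..j] \<in> factors A \<tau>)"
  by (auto simp: subst_subshift_def factors_def)

lemma funpow_split: "n \<le> m \<Longrightarrow> (f ^^ n) ((f ^^ (m - n)) x) = (f ^^ m) x"
  by (metis comp_apply funpow_add le_add_diff_inverse)

lemma sublist_in_factors: "w \<in> factors A \<tau> \<Longrightarrow> sublist v w \<Longrightarrow> v \<in> factors A \<tau>"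
  unfolding factors_def using sublist_order.order_trans by blast

lemma sublist_singleton_iff: "sublist [a] w \<longleftrightarrow> a \<in> set w"
  by (auto simp: sublist_def in_set_conv_decomp)

text \<open>
  Kept apart from primitivity because the facts below are needed to establish primitivity in the first
  place, both for the matrix criterion and for the recoded substitution.
\<close>

locale word_morphism =
  fixes A :: "'a set" and \<tau> :: "'a list \<Rightarrow> 'a list"
  assumes endo: "free_monoid_endo A \<tau>"
begin

lemma pow_lists: "w \<in> lists A \<Longrightarrow> (\<tau> ^^ n) w \<in> lists A"
  using endo by (induction n) (auto simp: free_monoid_endo_def)

lemma pow_Nil [simp]: "(\<tau> ^^ n) [] = []"
  using endo by (induction n) (auto simp: free_monoid_endo_def)

lemma pow_append:
  assumes "u \<in> lists A" "v \<in> lists A"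
  shows "(\<tau> ^^ n) (u @ v) = (\<tau> ^^ n) u @ (\<tau> ^^ n) v"
  using endo pow_lists assms by (induction n) (auto simp: free_monoid_endo_def)

lemma pow_Cons:
  assumes "b \<in> A" "v \<in> lists A"
  shows "(\<tau> ^^ n) (b # v) = (\<tau> ^^ n) [b] @ (\<tau> ^^ n) v"
  using pow_append[of "[b]" v n] assms by simp

lemma endo_pow: "free_monoid_endo A (\<tau> ^^ n)"
  using pow_lists pow_append by (auto simp: free_monoid_endo_def)

lemma sublist_pow:
  assumes "sublist u v" "v \<in> lists A"
  shows "sublist ((\<tau> ^^ n) u) ((\<tau> ^^ n) v)"
proof -
  obtain p q where v: "v = p @ u @ q"
    using assms(1) by (auto simp: sublist_def)
  have "(\<tau> ^^ n) v = (\<tau> ^^ n) p @ (\<tau> ^^ n) u @ (\<tau> ^^ n) q"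
    using assms(2) by (simp add: v pow_append)
  then show ?thesis by simp
qed

lemma set_pow: "w \<in> lists A \<Longrightarrow> set ((\<tau> ^^ n) w) = (\<Union>a\<in>set w. set ((\<tau> ^^ n) [a]))"
proof (induction w)
  case (Cons b w)
  then show ?case by (simp add: pow_Cons[of b w n])
qed simp

lemma count_list_image:
  assumes "finite A" "w \<in> lists A"
  shows "count_list (\<tau> w) b = (\<Sum>c\<in>A. count_list (\<tau> [c]) b * count_list w c)"
  using assms(2)
proof (induction w)
  case Nil
  then show ?case using pow_Nil[of 1] by simp
next
  case (Cons d w)
  have "(\<Sum>c\<in>A. count_list (\<tau> [c]) b * count_list (d # w) c) =
        (\<Sum>c\<in>A. count_list (\<tau> [c]) b * count_list w c + (if c = d then count_list (\<tau> [c]) b else 0))"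
    by (rule sum.cong) auto
  also have "\<dots> = count_list (\<tau> w) b + count_list (\<tau> [d]) b"
    using Cons assms(1) by (simp add: sum.distrib)
  finally show ?case
    using pow_Cons[of d w 1] Cons by simp
qed

text \<open>
  Turns the matrix condition into a statement about occurrences of letters, which is the only form of
  primitivity used from here on.
\<close>

lemma matrix_power_incidence:
  assumes "finite A" "a \<in> A"
  shows "matrix_power A (incidence_matrix \<tau>) k b a = count_list ((\<tau> ^^ k) [a]) b"
proof (induction k arbitrary: b)
  case (Suc k)
  have "(\<tau> ^^ k) [a] \<in> lists A" using assms(2) pow_lists by simp
  then show ?case
    using count_list_image[OF assms(1), of "(\<tau> ^^ k) [a]" b]
    by (simp add: Suc) (simp add: incidence_matrix_def)
qed auto

end

lemma primitive_substitution_iff: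
  "primitive_substitution A \<tau> \<longleftrightarrow>
     substitution A \<tau> \<and> (\<exists>k\<ge>1. \<forall>a\<in>A. \<forall>b\<in>A. b \<in> set ((\<tau> ^^ k) [a]))"
proof (cases "substitution A \<tau>")
  case True
  then interpret word_morphism A \<tau>
    by unfold_locales (simp add: substitution_def)
  have "finite A" using True by (simp add: substitution_def)
  moreover have "0 < count_list w b \<longleftrightarrow> b \<in> set w" for w :: "'a list" and b
    using count_list_0_iff[of w b] by auto
  ultimately have "(\<forall>b\<in>A. \<forall>a\<in>A. matrix_power A (incidence_matrix \<tau>) k b a > 0) \<longleftrightarrow>
      (\<forall>a\<in>A. \<forall>b\<in>A. b \<in> set ((\<tau> ^^ k) [a]))" for k
    using matrix_power_incidence by metis
  then show ?thesis
    using True by (simp add: primitive_substitution_def)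
qed (simp add: primitive_substitution_def)

locale prim_subst =
  fixes A :: "'a set" and \<tau> :: "'a list \<Rightarrow> 'a list"
  assumes prim: "primitive_substitution A \<tau>"

sublocale prim_subst \<subseteq> word_morphism A \<tau>
  by unfold_locales (use prim in \<open>auto simp: primitive_substitution_def substitution_def\<close>)

context prim_subst
begin

lemma finA: "finite A" and card_A: "2 \<le> card A"
  and nonerasing: "a \<in> A \<Longrightarrow> \<tau> [a] \<noteq> []"
  and letter_occurs: "b \<in> A \<Longrightarrow> \<exists>a\<in>A. b \<in> set (\<tau> [a])"
  using prim by (auto simp: primitive_substitution_def substitution_def)

lemma A_nonempty: "A \<noteq> {}"
  using card_A by auto

lemma pow_letter_neq_Nil: "a \<in> A \<Longrightarrow> (\<tau> ^^ n) [a] \<noteq> []"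
proof (induction n)
  case (Suc n)
  then obtain b v where bv: "(\<tau> ^^ n) [a] = b # v"
    by (meson list.exhaust)
  moreover have "b # v \<in> lists A"
    using pow_lists[of "[a]" n] Suc bv by simp
  ultimately show ?case
    using pow_Cons[of b v 1] nonerasing by simp
qed simp

lemma length_pow_ge: "w \<in> lists A \<Longrightarrow> length w \<le> length ((\<tau> ^^ n) w)"
proof (induction w)
  case (Cons b w)
  have "1 \<le> length ((\<tau> ^^ n) [b])"
    using pow_letter_neq_Nil[of b n] Cons by (simp add: Suc_le_eq)
  then show ?case
    using Cons pow_Cons[of b w n] by simp
qed simp

lemma pow_neq_Nil: "w \<in> lists A \<Longrightarrow> w \<noteq> [] \<Longrightarrow> (\<tau> ^^ n) w \<noteq> []"
  using length_pow_ge[of w n] by auto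

text \<open>
  For \<open>j \<ge> k\<close> the word \<open>\<tau>\<^sup>j(a)\<close> is the image under \<open>\<tau>\<^sup>k\<close> of a nonempty word, so positivity of the
  \<open>k\<close>-th power of the incidence matrix is inherited by all later powers.
\<close>

lemma all_letters_occur: "\<exists>k\<ge>1. \<forall>j\<ge>k. \<forall>a\<in>A. \<forall>b\<in>A. b \<in> set ((\<tau> ^^ j) [a])"
proof -
  obtain k where k: "k \<ge> 1" "\<And>a b. a \<in> A \<Longrightarrow> b \<in> A \<Longrightarrow> b \<in> set ((\<tau> ^^ k) [a])"
    using prim by (auto simp: primitive_substitution_iff)
  have "b \<in> set ((\<tau> ^^ j) [a])" if "j \<ge> k" "a \<in> A" "b \<in> A" for j a b
  proof -
    have l: "(\<tau> ^^ (j - k)) [a] \<in> lists A" and "(\<tau> ^^ (j - k)) [a] \<noteq> []"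
      using that pow_lists pow_letter_neq_Nil by simp_all
    then obtain c where c: "c \<in> set ((\<tau> ^^ (j - k)) [a])" "c \<in> A"
      by (metis in_listsD list.set_sel(1))
    have "(\<tau> ^^ j) [a] = (\<tau> ^^ k) ((\<tau> ^^ (j - k)) [a])"
      using that(1) by (simp add: funpow_split)
    then show ?thesis
      using set_pow[OF l, of k] c k(2)[OF c(2) that(3)] by auto
  qed
  then show ?thesis using k(1) by blast
qed

lemma factors_in_lists: "w \<in> factors A \<tau> \<Longrightarrow> w \<in> lists A"
proof -
  assume "w \<in> factors A \<tau>"
  then obtain n a where "a \<in> A" "sublist w ((\<tau> ^^ n) [a])"
    by (auto simp: factors_def)
  then show ?thesis
    using pow_lists[of "[a]" n] set_mono_sublist by fastforce
qed

lemma pow_in_factors: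
  assumes "w \<in> factors A \<tau>"
  shows "(\<tau> ^^ n) w \<in> factors A \<tau>"
proof -
  obtain m a where m: "m \<ge> 1" "a \<in> A" "sublist w ((\<tau> ^^ m) [a])"
    using assms by (auto simp: factors_def)
  have "sublist ((\<tau> ^^ n) w) ((\<tau> ^^ (n + m)) [a])"
    using sublist_pow[OF m(3), of n] m(2) pow_lists by (simp add: funpow_add)
  then show ?thesis
    unfolding factors_def using m by (auto intro!: exI[of _ "n + m"])
qed

lemma factor_in_all_large_powers:
  assumes "w \<in> factors A \<tau>"
  shows "\<exists>n0. \<forall>n\<ge>n0. \<forall>e\<in>A. sublist w ((\<tau> ^^ n) [e])"
proof -
  obtain m a where m: "a \<in> A" "sublist w ((\<tau> ^^ m) [a])"
    using assms by (auto simp: factors_def)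
  obtain k where k: "\<And>j a b. j \<ge> k \<Longrightarrow> a \<in> A \<Longrightarrow> b \<in> A \<Longrightarrow> b \<in> set ((\<tau> ^^ j) [a])"
    using all_letters_occur by blast
  have "sublist w ((\<tau> ^^ n) [e])" if n: "n \<ge> m + k" "e \<in> A" for n e
  proof -
    have "sublist [a] ((\<tau> ^^ (n - m)) [e])"
      using k[of "n - m" e a] n m by (simp add: sublist_singleton_iff)
    then have "sublist ((\<tau> ^^ m) [a]) ((\<tau> ^^ m) ((\<tau> ^^ (n - m)) [e]))"
      by (rule sublist_pow) (use n pow_lists in simp)
    also have "(\<tau> ^^ m) ((\<tau> ^^ (n - m)) [e]) = (\<tau> ^^ n) [e]"
      using n(1) by (simp add: funpow_split)
    finally show ?thesis using m(2) by (meson sublist_order.order_trans)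
  qed
  then show ?thesis by blast
qed

lemma singleton_in_factors:
  assumes "a \<in> A"
  shows "[a] \<in> factors A \<tau>"
proof -
  obtain b where "b \<in> A" "a \<in> set (\<tau> [b])"
    using letter_occurs assms by blast
  then show ?thesis
    by (auto simp: factors_def sublist_singleton_iff intro!: exI[of _ 1] bexI[of _ b])
qed

text \<open>
  Since there are at least two letters, \<open>\<tau>\<^sup>k(b)\<close> has at least two letters once it contains all of them;
  each further application of \<open>\<tau>\<^sup>k\<close> then makes a word strictly longer, and \<open>\<tau>\<close> never shortens words.
\<close>

lemma lengths_unbounded: "\<exists>n0. \<forall>n\<ge>n0. \<forall>b\<in>A. R \<le> length ((\<tau> ^^ n) [b])"
proof -
  obtain k where k: "\<And>a b. a \<in> A \<Longrightarrow> b \<in> A \<Longrightarrow> b \<in> set ((\<tau> ^^ k) [a])"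
    using prim by (auto simp: primitive_substitution_iff)
  have double: "2 \<le> length ((\<tau> ^^ k) [b])" if "b \<in> A" for b
  proof -
    have "A \<subseteq> set ((\<tau> ^^ k) [b])" using k that by blast
    then have "card A \<le> card (set ((\<tau> ^^ k) [b]))" by (intro card_mono) auto
    then show ?thesis
      using card_A card_length[of "(\<tau> ^^ k) [b]"] by linarith
  qed
  have grow: "length w + 1 \<le> length ((\<tau> ^^ k) w)" if w: "w \<in> lists A" "w \<noteq> []" for w
  proof -
    obtain b v where "w = b # v" "b \<in> A" "v \<in> lists A"
      using w by (cases w) auto
    then show ?thesis
      using pow_Cons[of b v k] double[of b] length_pow_ge[of v k] by simp
  qed
  have R: "R \<le> length ((\<tau> ^^ (k * R)) [b])" if "b \<in> A" for b
  proof (induction R)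
    case (Suc R)
    have "(\<tau> ^^ (k * Suc R)) [b] = (\<tau> ^^ k) ((\<tau> ^^ (k * R)) [b])"
      by (simp add: funpow_add)
    then show ?case
      using grow[of "(\<tau> ^^ (k * R)) [b]"] Suc pow_lists pow_letter_neq_Nil that by simp
  qed simp
  have "R \<le> length ((\<tau> ^^ n) [b])" if "n \<ge> k * R" "b \<in> A" for n b
  proof -
    have "(\<tau> ^^ n) [b] = (\<tau> ^^ (n - k * R)) ((\<tau> ^^ (k * R)) [b])"
      using that(1) by (metis comp_apply funpow_add le_add_diff_inverse2)
    then show ?thesis
      using R[OF that(2)] length_pow_ge[of "(\<tau> ^^ (k * R)) [b]" "n - k * R"] pow_lists that
      by (metis in_lists_conv_set empty_iff empty_set le_trans set_ConsD)
  qed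
  then show ?thesis by blast
qed

text \<open>
  In a power \<open>\<tau>\<^sup>i(e)\<close> with at least three letters, some letter \<open>d\<close> has neighbours on both sides. If \<open>w\<close>
  occurs in \<open>\<tau>\<^sup>m(d)\<close>, these neighbours provide letters on both sides of \<open>w\<close> in \<open>\<tau>\<^bsup>m+i\<^esup>(e)\<close>.
\<close>

lemma factor_extends:
  assumes "w \<in> factors A \<tau>"
  shows "\<exists>l r. l # w @ [r] \<in> factors A \<tau>"
proof -
  obtain m where m: "\<And>e. e \<in> A \<Longrightarrow> sublist w ((\<tau> ^^ m) [e])"
    using factor_in_all_large_powers[OF assms] by blast
  obtain e where e: "e \<in> A" using A_nonempty by blast
  obtain i where i: "3 \<le> length ((\<tau> ^^ i) [e])"
    using lengths_unbounded e by blast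
  then obtain x d y z where v: "(\<tau> ^^ i) [e] = x # d # y # z"
    by (metis One_nat_def Suc_le_length_iff numeral_3_eq_3)
  then have inA: "x \<in> A" "d \<in> A" "y \<in> A" "z \<in> lists A"
    using pow_lists[of "[e]" i] e by auto
  obtain p q where d: "(\<tau> ^^ m) [d] = p @ w @ q"
    using m[OF inA(2)] by (auto simp: sublist_def)
  have "(\<tau> ^^ m) ((\<tau> ^^ i) [e]) = ((\<tau> ^^ m) [x] @ p) @ w @ (q @ (\<tau> ^^ m) (y # z))"
    using inA pow_Cons[of x "d # y # z" m] pow_Cons[of d "y # z" m] by (simp add: v d)
  moreover obtain u l where "(\<tau> ^^ m) [x] @ p = u @ [l]"
    using pow_letter_neq_Nil[OF inA(1)] by (metis append_is_Nil_conv rev_exhaust)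
  moreover obtain r u' where "q @ (\<tau> ^^ m) (y # z) = r # u'"
    using pow_neq_Nil[of "y # z" m] inA by (metis append_is_Nil_conv list.distinct(1) list.exhaust lists.Cons)
  ultimately have "(\<tau> ^^ m) ((\<tau> ^^ i) [e]) = u @ (l # w @ [r]) @ u'"
    by simp
  moreover have "(\<tau> ^^ m) ((\<tau> ^^ i) [e]) \<in> factors A \<tau>"
    using singleton_in_factors[OF e] pow_in_factors by blast
  ultimately show ?thesis
    using sublist_in_factors by (metis sublist_appendI)
qed

text \<open>
  The subshift is defined by forbidding words only, so it has to be shown that it has enough points.
  Extending a factor again and again by one letter on each side produces one that carries it.
\<close>

lemma factor_in_point:
  assumes "w \<in> factors A \<tau>"
  shows "\<exists>x\<in>subst_subshift A \<tau>. \<forall>i<length w. x (int i) = w ! i"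
proof -
  obtain L R where LR: "\<And>v. v \<in> factors A \<tau> \<Longrightarrow> L v # v @ [R v] \<in> factors A \<tau>"
    using factor_extends by metis
  define e where "e = (\<lambda>n. ((\<lambda>v. L v # v @ [R v]) ^^ n) w)"
  have e0: "e 0 = w" and eS: "e (Suc n) = L (e n) # e n @ [R (e n)]" for n
    by (simp_all add: e_def)
  have e_fac: "e n \<in> factors A \<tau>" for n
    by (induction n) (simp_all add: e0 eS LR assms)
  have e_len: "length (e n) = length w + 2 * n" for n
    by (induction n) (simp_all add: e0 eS)
  \<comment> \<open>Each step adds a letter in front, so position \<open>i\<close> of the point to be built has index \<open>i + n\<close> in
    \<open>e n\<close>; any \<open>n > \<bar>i\<bar>\<close> can be used to define it.\<close>
  have e_step: "e (Suc n) ! Suc j = e n ! j" if "j < length (e n)" for n j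
    using that by (simp add: eS nth_append)
  have e_mono: "e (n + m) ! (j + m) = e n ! j" if "j < length (e n)" for n m j
  proof (induction m)
    case (Suc m)
    have "j + m < length (e (n + m))" using that by (simp add: e_len)
    then show ?case using e_step[of "j + m" "n + m"] Suc by simp
  qed simp
  define x where "x = (\<lambda>i::int. e (nat \<bar>i\<bar> + 1) ! nat (i + \<bar>i\<bar> + 1))"
  have x_eq: "x i = e n ! nat (i + int n)" if "- int n \<le> i" "i < int (length w) + int n" for i n
  proof -
    define N where "N = nat \<bar>i\<bar> + 1"
    have a: "e (n + N) ! (nat (i + int n) + N) = e n ! nat (i + int n)"
      by (rule e_mono) (use that in \<open>simp add: e_len\<close>)
    have b: "e (N + n) ! (nat (i + \<bar>i\<bar> + 1) + n) = e N ! nat (i + \<bar>i\<bar> + 1)"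
      by (rule e_mono) (auto simp: e_len N_def)
    have "nat (i + int n) + N = nat (i + \<bar>i\<bar> + 1) + n"
      using that by (simp add: N_def)
    moreover have "x i = e N ! nat (i + \<bar>i\<bar> + 1)"
      by (simp add: x_def N_def)
    ultimately show ?thesis
      using a b by (metis add.commute)
  qed
  have map_x: "sublist (map x [i..j]) (e n)" if n: "nat \<bar>i\<bar> + nat \<bar>j\<bar> < n" for i j n
  proof (cases "i \<le> j")
    case True
    have "map x [i..j] = take (nat (j - i + 1)) (drop (nat (i + int n)) (e n))"
    proof (rule nth_equalityI)
      show "length (map x [i..j]) = length (take (nat (j - i + 1)) (drop (nat (i + int n)) (e n)))"
        using n True by (auto simp: e_len)
    next
      fix k assume k: "k < length (map x [i..j])"
      then have "map x [i..j] ! k = x (i + int k)"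
        by (simp add: nth_upto)
      also have "\<dots> = e n ! nat (i + int k + int n)"
        by (rule x_eq) (use n k in auto)
      also have ix: "nat (i + int k + int n) = nat (i + int n) + k"
        using n by linarith
      also have "e n ! (nat (i + int n) + k) = take (nat (j - i + 1)) (drop (nat (i + int n)) (e n)) ! k"
        using n k by (simp add: ix e_len)
      finally show "map x [i..j] ! k = take (nat (j - i + 1)) (drop (nat (i + int n)) (e n)) ! k" .
    qed
    then show ?thesis
      by (metis sublist_drop sublist_order.order_trans sublist_take)
  qed simp
  have fac: "map x [i..j] \<in> factors A \<tau>" for i j
    using map_x e_fac sublist_in_factors lessI by blast
  have "x i \<in> A" for i
    using factors_in_lists[OF fac[of i i]] by simp
  then have "x \<in> subst_subshift A \<tau>"
    using fac by (auto simp: subst_subshift_iff_factors)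
  moreover have "x (int i) = w ! i" if "i < length w" for i
    using x_eq[of 0 "int i"] that by (simp add: e0)
  ultimately show ?thesis by blast
qed

lemma factor_in_language:
  assumes "w \<in> factors A \<tau>"
  shows "w \<in> language (subst_subshift A \<tau>)"
proof -
  obtain x where x: "x \<in> subst_subshift A \<tau>" "\<And>i. i < length w \<Longrightarrow> x (int i) = w ! i"
    using factor_in_point[OF assms] by blast
  have "w = map x [0..int (length w) - 1]"
    by (rule nth_equalityI) (simp_all add: x nth_upto)
  then show ?thesis
    unfolding language_def using x(1) by blast
qed

text \<open>
  By recurrence a factor of \<open>\<tau>\<close> occurs in all high powers of \<open>\<tau>\<close>, in particular in those whose exponent
  is a multiple of \<open>N\<close>. This is why \<open>\<tau>\<close> may be replaced by its powers without changing the subshift.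
\<close>

lemma factors_pow:
  assumes "N \<ge> 1"
  shows "factors A (\<tau> ^^ N) = factors A \<tau>"
proof (rule antisym; rule subsetI)
  fix w assume "w \<in> factors A (\<tau> ^^ N)"
  then obtain n a where "n \<ge> 1" "a \<in> A" "sublist w ((\<tau> ^^ (N * n)) [a])"
    by (auto simp: factors_def funpow_mult)
  moreover from this assms have "1 \<le> N * n" by simp
  ultimately show "w \<in> factors A \<tau>"
    unfolding factors_def by blast
next
  fix w assume "w \<in> factors A \<tau>"
  then obtain n0 where n0: "\<And>n e. n \<ge> n0 \<Longrightarrow> e \<in> A \<Longrightarrow> sublist w ((\<tau> ^^ n) [e])"
    using factor_in_all_large_powers by blast
  obtain e where e: "e \<in> A" using A_nonempty by blast
  have "n0 \<le> N * (n0 + 1)"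
    using assms by (metis add_leD1 le_add1 mult_le_mono1 nat_mult_1 order_trans)
  then have "sublist w (((\<tau> ^^ N) ^^ (n0 + 1)) [e])"
    using n0 e by (simp only: funpow_mult)
  then show "w \<in> factors A (\<tau> ^^ N)"
    unfolding factors_def using e by force
qed

lemma subst_subshift_pow: "N \<ge> 1 \<Longrightarrow> subst_subshift A (\<tau> ^^ N) = subst_subshift A \<tau>"
  using factors_pow by (auto simp: subst_subshift_iff_factors)

lemma prim_subst_pow:
  assumes "N \<ge> 1"
  shows "prim_subst A (\<tau> ^^ N)"
proof
  have occ: "\<exists>a\<in>A. b \<in> set ((\<tau> ^^ N) [a])" if "b \<in> A" for b N
    using that
  proof (induction N arbitrary: b)
    case (Suc N)
    then obtain c where c: "c \<in> A" "b \<in> set (\<tau> [c])" using letter_occurs by blast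
    obtain a where a: "a \<in> A" "c \<in> set ((\<tau> ^^ N) [a])" using Suc.IH c by blast
    have "b \<in> set (\<tau> ((\<tau> ^^ N) [a]))"
      using set_pow[of "(\<tau> ^^ N) [a]" 1] pow_lists a c by auto
    then show ?case using a by auto
  qed auto
  obtain k where k: "k \<ge> 1" "\<And>j a b. j \<ge> k \<Longrightarrow> a \<in> A \<Longrightarrow> b \<in> A \<Longrightarrow> b \<in> set ((\<tau> ^^ j) [a])"
    using all_letters_occur by blast
  have "k \<le> N * k" using assms by simp
  then have "\<forall>a\<in>A. \<forall>b\<in>A. b \<in> set (((\<tau> ^^ N) ^^ k) [a])"
    using k(2) by (simp add: funpow_mult)
  then show "primitive_substitution A (\<tau> ^^ N)"
    using k(1) endo_pow finA card_A pow_letter_neq_Nil occ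
    by (auto simp: primitive_substitution_iff substitution_def)
qed

end

section \<open>Eigenfunctions and the distance to the integers\<close>

lemma dist_int_attained: "\<exists>z\<in>\<int>. dist_int t = \<bar>t - z\<bar>"
  using infdist_attains_inf[OF closed_Ints] Ints_0 by (metis dist_real_def empty_iff)

lemma dist_int_le: "z \<in> \<int> \<Longrightarrow> dist_int t \<le> \<bar>t - z\<bar>"
  by (metis dist_real_def infdist_le)

lemma dist_int_add: "dist_int (s + t) \<le> dist_int s + dist_int t"
proof -
  obtain y z where yz: "y \<in> \<int>" "dist_int s = \<bar>s - y\<bar>" "z \<in> \<int>" "dist_int t = \<bar>t - z\<bar>"
    using dist_int_attained by blast
  then have "dist_int (s + t) \<le> \<bar>s + t - (y + z)\<bar>"
    by (intro dist_int_le) auto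
  then show ?thesis using yz by linarith
qed

lemma dist_int_minus: "dist_int (- t) = dist_int t"
proof -
  have "dist_int (- t) \<le> dist_int t" for t :: real
  proof -
    obtain z where z: "z \<in> \<int>" "dist_int t = \<bar>t - z\<bar>"
      using dist_int_attained by blast
    then show ?thesis using dist_int_le[of "- z" "- t"] by simp
  qed
  from this[of t] this[of "- t"] show ?thesis by simp
qed

lemma dist_int_diff: "dist_int (s - t) \<le> dist_int s + dist_int t"
  using dist_int_add[of s "- t"] by (simp add: dist_int_minus)

lemma dist_int_cong: "s - t \<in> \<int> \<Longrightarrow> dist_int s = dist_int t"
  using dist_int_add[of "s - t" t] dist_int_add[of "t - s" s] dist_int_minus[of "s - t"]
  by (simp add: infdist_zero)

lemma dist_int_le_1: "dist_int t \<le> 1"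
  using dist_int_le[of "of_int \<lfloor>t\<rfloor>" t] by simp linarith

lemma dist_int_pos: "t \<notin> \<int> \<Longrightarrow> 0 < dist_int t"
  using dist_int_attained[of t] infdist_nonneg[of t \<int>] by fastforce

lemma coset_ints_eq_iff: "s +o \<int> = t +o \<int> \<longleftrightarrow> s - t \<in> (\<int> :: real set)"
proof
  assume "s +o \<int> = t +o (\<int> :: real set)"
  moreover have "s \<in> s +o (\<int> :: real set)"
    by (simp add: set_zero_plus2 elt_set_plus_def)
  ultimately show "s - t \<in> \<int>" by (auto simp: elt_set_plus_def)
next
  assume st: "s - t \<in> \<int>"
  have "s + b = t + (s - t + b)" "t + b = s + (b - (s - t))" for b by simp_all
  then show "s +o \<int> = t +o (\<int> :: real set)"
    using Ints_add[OF st] Ints_diff[OF _ st] unfolding elt_set_plus_def by blast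
qed

lemma openin_dist_int_ball:
  "openin reals_mod_ints ((\<lambda>t. t +o \<int>) ` {t. dist_int (t - h) < \<epsilon>})" (is "openin _ (?q ` ?V)")
proof -
  have "?q -` (?q ` ?V) = ?V"
  proof
    show "?q -` (?q ` ?V) \<subseteq> ?V"
    proof
      fix t assume "t \<in> ?q -` (?q ` ?V)"
      then obtain s where "dist_int (s - h) < \<epsilon>" "t - s \<in> \<int>"
        by (auto simp: coset_ints_eq_iff)
      then show "t \<in> ?V" using dist_int_cong[of "t - h" "s - h"] by simp
    qed
  qed auto
  moreover have "open ?V"
    by (intro open_Collect_less continuous_intros)
  ultimately show ?thesis
    by (auto simp: openin_reals_mod_ints)
qed

lemma topspace_subshift_topology: "X \<subseteq> UNIV \<rightarrow> A \<Longrightarrow> topspace (subshift_topology A X) = X"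
  by (auto simp: subshift_topology_def PiE_UNIV_domain)

lemma openin_cylinder:
  assumes "finite K" "X \<subseteq> UNIV \<rightarrow> A"
  shows "openin (subshift_topology A X) {y\<in>X. \<forall>k\<in>K. y k = x k}"
proof -
  have "openin (product_topology (\<lambda>_. discrete_topology A) UNIV)
          (\<Pi>\<^sub>E k\<in>UNIV. if k \<in> K then {x k} \<inter> A else A)"
    by (rule product_topology_basis)
       (auto intro: finite_subset[OF _ assms(1)] split: if_splits)
  moreover have "{y\<in>X. \<forall>k\<in>K. y k = x k} = (\<Pi>\<^sub>E k\<in>UNIV. if k \<in> K then {x k} \<inter> A else A) \<inter> X"
    using assms(2) by (fastforce simp: PiE_UNIV_domain Pi_iff split: if_splits)
  ultimately show ?thesis
    by (auto simp: subshift_topology_def openin_subtopology)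
qed

lemma openin_subshift_iff:
  assumes X: "X \<subseteq> UNIV \<rightarrow> A"
  shows "openin (subshift_topology A X) U \<longleftrightarrow>
    U \<subseteq> X \<and> (\<forall>x\<in>U. \<exists>K. finite K \<and> {y\<in>X. \<forall>k\<in>K. y k = x k} \<subseteq> U)"
proof (intro iffI conjI ballI)
  assume U: "openin (subshift_topology A X) U"
  then show "U \<subseteq> X" using openin_subset topspace_subshift_topology[OF X] by metis
  fix x assume x: "x \<in> U"
  obtain V where V: "openin (product_topology (\<lambda>_. discrete_topology A) UNIV) V" "U = V \<inter> X"
    using U by (auto simp: subshift_topology_def openin_subtopology)
  obtain W where W: "finite {k. W k \<noteq> A}" "x \<in> Pi\<^sub>E UNIV W" "Pi\<^sub>E UNIV W \<subseteq> V"
    using V x by (auto simp: openin_product_topology_alt)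
  have "{y\<in>X. \<forall>k\<in>{k. W k \<noteq> A}. y k = x k} \<subseteq> U"
  proof
    fix y assume y: "y \<in> {y\<in>X. \<forall>k\<in>{k. W k \<noteq> A}. y k = x k}"
    have "y k \<in> W k" for k
    proof (cases "W k = A")
      case True
      then show ?thesis using y X by blast
    next
      case False
      then have "y k = x k" using y by simp
      then show ?thesis using W(2) by auto
    qed
    then show "y \<in> U" using W(3) V(2) y by auto
  qed
  then show "\<exists>K. finite K \<and> {y\<in>X. \<forall>k\<in>K. y k = x k} \<subseteq> U" using W(1) by blast
next
  assume R: "U \<subseteq> X \<and> (\<forall>x\<in>U. \<exists>K. finite K \<and> {y\<in>X. \<forall>k\<in>K. y k = x k} \<subseteq> U)"
  show "openin (subshift_topology A X) U"
    unfolding openin_subopen[of _ U]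
  proof
    fix x assume x: "x \<in> U"
    then obtain K where "finite K" "{y\<in>X. \<forall>k\<in>K. y k = x k} \<subseteq> U" using R by blast
    then show "\<exists>T. openin (subshift_topology A X) T \<and> x \<in> T \<and> T \<subseteq> U"
      using openin_cylinder[OF _ X, of K x] x R by (intro exI[of _ "{y\<in>X. \<forall>k\<in>K. y k = x k}"]) auto
  qed
qed

text \<open>
  The easy half of the Curtis-Hedlund-Lyndon theorem: it covers the two-block code as well as its
  inverse.
\<close>

lemma continuous_map_locally_determined:
  assumes X: "X \<subseteq> UNIV \<rightarrow> A" and Y: "Y \<subseteq> UNIV \<rightarrow> B" and f: "f \<in> X \<rightarrow> Y"
    and loc: "\<And>i. \<exists>K. finite K \<and> (\<forall>x\<in>X. \<forall>y\<in>X. (\<forall>k\<in>K. x k = y k) \<longrightarrow> f x i = f y i)"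
  shows "continuous_map (subshift_topology A X) (subshift_topology B Y) f"
proof -
  obtain K where K: "\<And>i. finite (K i)"
    "\<And>i x y. x \<in> X \<Longrightarrow> y \<in> X \<Longrightarrow> (\<forall>k\<in>K i. x k = y k) \<Longrightarrow> f x i = f y i"
    using loc by metis
  have "openin (subshift_topology A X) {x \<in> X. f x \<in> U}" if U: "openin (subshift_topology B Y) U" for U
    unfolding openin_subshift_iff[OF X]
  proof (intro conjI ballI)
    fix x assume x: "x \<in> {x \<in> X. f x \<in> U}"
    then obtain M where M: "finite M" "{y\<in>Y. \<forall>k\<in>M. y k = f x k} \<subseteq> U"
      using U by (auto simp: openin_subshift_iff[OF Y])
    have "{y\<in>X. \<forall>k\<in>(\<Union>i\<in>M. K i). y k = x k} \<subseteq> {x \<in> X. f x \<in> U}"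
      using M(2) f K(2) x by blast
    then show "\<exists>K. finite K \<and> {y\<in>X. \<forall>k\<in>K. y k = x k} \<subseteq> {x \<in> X. f x \<in> U}"
      using K(1) M(1) by (intro exI[of _ "\<Union>i\<in>M. K i"]) auto
  qed auto
  then show ?thesis
    using f topspace_subshift_topology[OF X] topspace_subshift_topology[OF Y]
    by (simp add: continuous_map_def)
qed

text \<open>
  A point outside the subshift has a window showing a forbidden word, and every point that agrees with
  it on this window is outside as well. So the subshift is closed in a product of finite discrete
  spaces.
\<close>

lemma compact_subst_subshift:
  assumes "finite A"
  shows "compactin (subshift_topology A (subst_subshift A \<tau>)) (subst_subshift A \<tau>)"
proof -
  let ?P = "product_topology (\<lambda>_::int. discrete_topology A) UNIV"
  let ?X = "subst_subshift A \<tau>"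
  have P: "subshift_topology A (UNIV \<rightarrow> A) = ?P"
    by (simp add: subshift_topology_def subtopology_superset PiE_UNIV_domain)
  have tP: "topspace ?P = (UNIV \<rightarrow> A)" by (simp add: PiE_UNIV_domain)
  have XA: "?X \<subseteq> UNIV \<rightarrow> A" by (auto simp: subst_subshift_def)
  have "openin ?P ((UNIV \<rightarrow> A) - ?X)"
    unfolding P[symmetric] openin_subshift_iff[OF order_refl]
  proof (intro conjI ballI)
    fix x assume x: "x \<in> (UNIV \<rightarrow> A) - ?X"
    then obtain i j where ij: "map x [i..j] \<notin> factors A \<tau>"
      by (auto simp: subst_subshift_iff_factors)
    have "{y \<in> UNIV \<rightarrow> A. \<forall>k\<in>{i..j}. y k = x k} \<subseteq> (UNIV \<rightarrow> A) - ?X"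
    proof
      fix y assume y: "y \<in> {y \<in> UNIV \<rightarrow> A. \<forall>k\<in>{i..j}. y k = x k}"
      then have "map y [i..j] = map x [i..j]" by (auto intro: map_cong)
      then have "map y [i..j] \<notin> factors A \<tau>" using ij by metis
      then show "y \<in> (UNIV \<rightarrow> A) - ?X"
        using y by (auto simp only: subst_subshift_iff_factors)
    qed
    then show "\<exists>K. finite K \<and> {y \<in> UNIV \<rightarrow> A. \<forall>k\<in>K. y k = x k} \<subseteq> (UNIV \<rightarrow> A) - ?X"
      by blast
  qed auto
  then have "closedin ?P ?X"
    using XA tP by (simp add: closedin_def)
  moreover have "compact_space ?P"
    using assms by (simp add: compact_space_product_topology compact_space_discrete_topology)
  ultimately have "compactin ?P ?X" by (rule closedin_compact_space[rotated])
  then show ?thesis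
    by (simp add: subshift_topology_def compactin_subtopology)
qed

text \<open>
  Choosing representatives in \<open>\<real>\<close> of the cosets turns the eigenfunction into a real function that is
  only meaningful modulo 1. Compactness of the subshift gives its uniform continuity: the value modulo 1
  is determined up to \<open>\<epsilon>\<close> by finitely many coordinates.
\<close>

lemma eigenfunction_lift:
  assumes finA: "finite A" and ev: "eigenvalue A (subst_subshift A \<tau>) \<alpha>"
  defines "X \<equiv> subst_subshift A \<tau>"
  obtains h :: "(int \<Rightarrow> 'a) \<Rightarrow> real"
  where "\<And>x. x \<in> X \<Longrightarrow> h (shift x) - h x - \<alpha> \<in> \<int>"
    and "\<And>\<epsilon>. 0 < \<epsilon> \<Longrightarrow> \<exists>K. finite K \<and>
      (\<forall>x\<in>X. \<forall>y\<in>X. (\<forall>k\<in>K. x k = y k) \<longrightarrow> dist_int (h x - h y) < \<epsilon>)"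
proof -
  have XA: "X \<subseteq> UNIV \<rightarrow> A" by (auto simp: subst_subshift_def X_def)
  obtain g where g: "continuous_map (subshift_topology A X) reals_mod_ints g"
    "\<And>x. x \<in> X \<Longrightarrow> g (shift x) = \<alpha> +o g x"
    using ev by (auto simp: eigenvalue_def X_def)
  have "\<exists>t. g x = t +o \<int>" if "x \<in> X" for x
    using continuous_map_image_subset_topspace[OF g(1)] that
    by (auto simp: topspace_subshift_topology[OF XA] topspace_reals_mod_ints)
  then obtain h where h: "\<And>x. x \<in> X \<Longrightarrow> g x = h x +o \<int>" by metis
  have shiftX: "shift x \<in> X" if "x \<in> X" for x
  proof -
    have "map (shift x) [i..j] = map x [i+1..j+1]" for i j
      by (rule nth_equalityI) (auto simp: nth_upto shift_def algebra_simps)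
    then show ?thesis
      using that by (auto simp: X_def subst_subshift_iff_factors) (auto simp: shift_def)
  qed
  have "h (shift x) - h x - \<alpha> \<in> \<int>" if x: "x \<in> X" for x
  proof -
    have "h (shift x) +o \<int> = (\<alpha> + h x) +o \<int>"
      using g(2)[OF x] h[OF x] h[OF shiftX[OF x]] by (simp add: set_plus_rearrange2)
    then show ?thesis by (simp add: coset_ints_eq_iff algebra_simps)
  qed
  moreover have "\<exists>K. finite K \<and>
      (\<forall>x\<in>X. \<forall>y\<in>X. (\<forall>k\<in>K. x k = y k) \<longrightarrow> dist_int (h x - h y) < \<epsilon>)" if \<epsilon>: "0 < \<epsilon>" for \<epsilon>
  proof -
    have near: "\<exists>K. finite K \<and> (\<forall>y\<in>X. (\<forall>k\<in>K. y k = x k) \<longrightarrow> dist_int (h y - h x) < \<epsilon> / 2)"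
      if x: "x \<in> X" for x
    proof -
      let ?U = "{y \<in> X. g y \<in> (\<lambda>t. t +o \<int>) ` {t. dist_int (t - h x) < \<epsilon> / 2}}"
      have U: "openin (subshift_topology A X) ?U"
        using openin_continuous_map_preimage[OF g(1) openin_dist_int_ball, of "h x" "\<epsilon> / 2"]
        by (simp only: topspace_subshift_topology[OF XA])
      have in_U: "y \<in> ?U \<longleftrightarrow> dist_int (h y - h x) < \<epsilon> / 2" if y: "y \<in> X" for y
      proof
        assume "y \<in> ?U"
        then obtain t where "h y - t \<in> \<int>" "dist_int (t - h x) < \<epsilon> / 2"
          using h[OF y] by (auto simp: coset_ints_eq_iff)
        then show "dist_int (h y - h x) < \<epsilon> / 2"
          using dist_int_cong[of "h y - h x" "t - h x"] by simp
      qed (use h[OF y] y in auto)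
      have "x \<in> ?U" using in_U[OF x] \<epsilon> by (simp add: infdist_zero)
      then obtain K where K: "finite K" "{y\<in>X. \<forall>k\<in>K. y k = x k} \<subseteq> ?U"
        using U unfolding openin_subshift_iff[OF XA] by blast
      then show ?thesis using in_U by blast
    qed
    then obtain K where K: "\<And>x. x \<in> X \<Longrightarrow> finite (K x)"
      "\<And>x y. x \<in> X \<Longrightarrow> y \<in> X \<Longrightarrow> (\<forall>k\<in>K x. y k = x k) \<Longrightarrow> dist_int (h y - h x) < \<epsilon> / 2"
      by metis
    define C where "C = (\<lambda>x. {y\<in>X. \<forall>k\<in>K x. y k = x k})"
    have "\<exists>\<F>. finite \<F> \<and> \<F> \<subseteq> C ` X \<and> X \<subseteq> \<Union>\<F>"
    proof (rule compactinD)
      show "compactin (subshift_topology A X) X"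
        unfolding X_def by (rule compact_subst_subshift[OF finA])
      show "openin (subshift_topology A X) U" if "U \<in> C ` X" for U
        using that openin_cylinder[OF K(1) XA] by (auto simp: C_def)
      show "X \<subseteq> \<Union> (C ` X)" by (auto simp: C_def)
    qed
    then obtain F where F: "finite F" "F \<subseteq> X" "X \<subseteq> \<Union> (C ` F)"
      by (metis finite_subset_image)
    have "dist_int (h x - h y) < \<epsilon>"
      if xy: "x \<in> X" "y \<in> X" "\<forall>k\<in>(\<Union>z\<in>F. K z). x k = y k" for x y
    proof -
      obtain z where z: "z \<in> F" "x \<in> C z" using F(3) xy(1) by blast
      then have "dist_int (h x - h z) < \<epsilon> / 2" "dist_int (h y - h z) < \<epsilon> / 2"
        using K(2)[of z x] K(2)[of z y] F(2) xy by (auto simp: C_def)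
      then show ?thesis
        using dist_int_diff[of "h x - h z" "h y - h z"] by simp
    qed
    moreover have "finite (\<Union>z\<in>F. K z)" using F K(1) by blast
    ultimately show ?thesis by blast
  qed
  ultimately show thesis by (rule that)
qed

context prim_subst
begin

lemma word_in_point:
  assumes "x @ u @ y \<in> factors A \<tau>"
  obtains z where "z \<in> subst_subshift A \<tau>"
    "\<And>k. - int (length x) \<le> k \<Longrightarrow> k < int (length u + length y) \<Longrightarrow>
       z k = (x @ u @ y) ! nat (k + int (length x))"
proof -
  obtain z0 where z0: "z0 \<in> subst_subshift A \<tau>"
    "\<And>i. i < length (x @ u @ y) \<Longrightarrow> z0 (int i) = (x @ u @ y) ! i"
    using factor_in_point[OF assms] by blast
  define z where "z = (\<lambda>k. z0 (k + int (length x)))"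
  have "map z [i..j] = map z0 [i + int (length x)..j + int (length x)]" for i j
    by (rule nth_equalityI) (auto simp: nth_upto z_def algebra_simps)
  then have "z \<in> subst_subshift A \<tau>"
    using z0(1) by (auto simp: subst_subshift_iff_factors z_def)
  moreover have "z k = (x @ u @ y) ! nat (k + int (length x))"
    if "- int (length x) \<le> k" "k < int (length u + length y)" for k
    using z0(2)[of "nat (k + int (length x))"] that by (simp add: z_def)
  ultimately show thesis by (rule that)
qed

text \<open>
  The combinatorial content of having the eigenvalue \<open>\<alpha>\<close>. For a word \<open>u\<close> inside a point, \<open>\<alpha> \<bar>u\<bar>\<close> is
  modulo 1 the difference of the values of the eigenfunction at the two ends of \<open>u\<close>, and these values
  depend up to a small error only on the \<open>R\<close> letters to either side of the ends. The words \<open>p\<close>, \<open>s\<close> are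
  the common context of the left end and \<open>p'\<close>, \<open>s'\<close> that of the right end.
\<close>

lemma length_determined_by_contexts:
  assumes ev: "eigenvalue A (subst_subshift A \<tau>) \<alpha>" and \<epsilon>: "0 < \<epsilon>"
  obtains R where
    "\<And>x u y x' u' y' p s p' s'. \<lbrakk>x @ u @ y \<in> factors A \<tau>; x' @ u' @ y' \<in> factors A \<tau>;
       suffix p x; suffix p x'; prefix s (u @ y); prefix s (u' @ y');
       suffix p' (x @ u); suffix p' (x' @ u'); prefix s' y; prefix s' y';
       R \<le> length p; R \<le> length s; R \<le> length p'; R \<le> length s'\<rbrakk>
     \<Longrightarrow> dist_int (\<alpha> * real (length u) - \<alpha> * real (length u')) < \<epsilon>"
proof -
  let ?X = "subst_subshift A \<tau>"
  obtain h where h: "\<And>x. x \<in> ?X \<Longrightarrow> h (shift x) - h x - \<alpha> \<in> \<int>"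
    "\<And>\<epsilon>. 0 < \<epsilon> \<Longrightarrow> \<exists>K. finite K \<and>
      (\<forall>x\<in>?X. \<forall>y\<in>?X. (\<forall>k\<in>K. x k = y k) \<longrightarrow> dist_int (h x - h y) < \<epsilon>)"
    using eigenfunction_lift[OF finA ev] by metis
  obtain K where K: "finite K"
    "\<And>x y. x \<in> ?X \<Longrightarrow> y \<in> ?X \<Longrightarrow> (\<forall>k\<in>K. x k = y k) \<Longrightarrow> dist_int (h x - h y) < \<epsilon> / 2"
    using h(2)[of "\<epsilon> / 2"] \<epsilon> by auto
  define T where "T = (\<lambda>n x i. x (i + int n) :: 'a)"
  have T_Suc: "T (Suc n) x = shift (T n x)" and T_0: "T 0 x = x" for n x
    by (simp_all add: T_def shift_def ac_simps)
  have T_X: "T n x \<in> ?X" if "x \<in> ?X" for n x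
  proof -
    have "map (T n x) [i..j] = map x [i + int n..j + int n]" for i j
      by (rule nth_equalityI) (auto simp: nth_upto T_def algebra_simps)
    then show ?thesis
      using that by (auto simp: subst_subshift_iff_factors) (auto simp: T_def)
  qed
  have h_T: "h (T n x) - h x - \<alpha> * real n \<in> \<int>" if "x \<in> ?X" for n x
  proof (induction n)
    case (Suc n)
    have "(h (T n x) - h x - \<alpha> * real n) + (h (shift (T n x)) - h (T n x) - \<alpha>) \<in> \<int>"
      using Suc h(1)[OF T_X[OF that]] by (intro Ints_add)
    then show ?case by (simp add: T_Suc algebra_simps)
  qed (simp add: T_0)
  obtain R where R: "\<And>k. k \<in> K \<Longrightarrow> nat \<bar>k\<bar> < R"
    using finite_nat_set_iff_bounded[of "(\<lambda>k. nat \<bar>k\<bar>) ` K"] K(1) by auto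
  show thesis
  proof (rule that[of R])
    fix x u y x' u' y' p s p' s'
    assume fac: "x @ u @ y \<in> factors A \<tau>" "x' @ u' @ y' \<in> factors A \<tau>"
      and p: "suffix p x" "suffix p x'" and s: "prefix s (u @ y)" "prefix s (u' @ y')"
      and p': "suffix p' (x @ u)" "suffix p' (x' @ u')" and s': "prefix s' y" "prefix s' y'"
      and len: "R \<le> length p" "R \<le> length s" "R \<le> length p'" "R \<le> length s'"
    obtain z where z: "z \<in> ?X" "\<And>k. - int (length x) \<le> k \<Longrightarrow> k < int (length u + length y) \<Longrightarrow>
       z k = (x @ u @ y) ! nat (k + int (length x))"
      using word_in_point[OF fac(1)] by blast
    obtain z' where z': "z' \<in> ?X" "\<And>k. - int (length x') \<le> k \<Longrightarrow> k < int (length u' + length y') \<Longrightarrow>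
       z' k = (x' @ u' @ y') ! nat (k + int (length x'))"
      using word_in_point[OF fac(2)] by blast
    \<comment> \<open>In a word with a cut after \<open>l\<close>, the letters near the cut are read off from the context.\<close>
    have window: "(l @ r) ! nat (k + int (length l)) =
        (if k < 0 then q ! nat (k + int (length q)) else t ! nat k)"
      if "suffix q l" "prefix t r" "R \<le> length q" "R \<le> length t" "k \<in> K" for l r q t :: "'a list" and k
    proof -
      obtain l0 r0 where l: "l = l0 @ q" and r: "r = t @ r0"
        using \<open>suffix q l\<close> \<open>prefix t r\<close> by (auto simp: suffix_def prefix_def)
      have k: "nat \<bar>k\<bar> < length q" "nat \<bar>k\<bar> < length t"
        using R[OF \<open>k \<in> K\<close>] that by auto
      show ?thesis
      proof (cases "k < 0")
        case True
        have "nat (k + int (length l)) = length l0 + nat (k + int (length q))"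
          using True k by (simp add: l nat_add_distrib)
        moreover have "nat (k + int (length q)) < length q" using True k by linarith
        ultimately show ?thesis using True by (simp add: l nth_append)
      next
        case False
        then have "nat (k + int (length l)) = length l + nat k"
          by (simp add: nat_add_distrib)
        then show ?thesis using False k by (simp add: r nth_append)
      qed
    qed
    have k_bd: "nat \<bar>k\<bar> < length p" "nat \<bar>k\<bar> < length s" "nat \<bar>k\<bar> < length p'" "nat \<bar>k\<bar> < length s'"
      if "k \<in> K" for k using R[OF that] len by auto
    have lens: "length p \<le> length x" "length p \<le> length x'"
       "length s \<le> length u + length y" "length s \<le> length u' + length y'"
       "length p' \<le> length x + length u" "length p' \<le> length x' + length u'"
       "length s' \<le> length y" "length s' \<le> length y'"
      using p s p' s' by (auto dest!: prefix_length_le suffix_length_le)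
    have "z k = z' k" if k: "k \<in> K" for k
      using z(2)[of k] z'(2)[of k] window[OF p(1) s(1) len(1,2) k] window[OF p(2) s(2) len(1,2) k]
        k_bd[OF k] lens by simp
    then have "dist_int (h z - h z') < \<epsilon> / 2"
      using K(2) z(1) z'(1) by blast
    moreover have "T (length u) z k = T (length u') z' k" if k: "k \<in> K" for k
    proof -
      have "T (length u) z k = (x @ u @ y) ! nat (k + int (length (x @ u)))"
        using z(2)[of "k + int (length u)"] k_bd[OF k] lens by (simp add: T_def ac_simps)
      moreover have "T (length u') z' k = (x' @ u' @ y') ! nat (k + int (length (x' @ u')))"
        using z'(2)[of "k + int (length u')"] k_bd[OF k] lens by (simp add: T_def ac_simps)
      ultimately show ?thesis
        using window[OF p'(1) s'(1) len(3,4) k] window[OF p'(2) s'(2) len(3,4) k] by simp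
    qed
    then have "dist_int (h (T (length u) z) - h (T (length u') z')) < \<epsilon> / 2"
      using K(2) T_X z(1) z'(1) by blast
    ultimately have "dist_int ((h (T (length u) z) - h (T (length u') z')) - (h z - h z')) < \<epsilon>"
      using dist_int_diff[of "h (T (length u) z) - h (T (length u') z')" "h z - h z'"] by simp
    moreover have "((h (T (length u) z) - h (T (length u') z')) - (h z - h z'))
        - (\<alpha> * real (length u) - \<alpha> * real (length u')) \<in> \<int>"
      using Ints_diff[OF h_T[OF z(1), of "length u"] h_T[OF z'(1), of "length u'"]]
      by (simp add: algebra_simps)
    ultimately show "dist_int (\<alpha> * real (length u) - \<alpha> * real (length u')) < \<epsilon>"
      using dist_int_cong by metis
  qed
qed

end

section \<open>Scaled lengths along the powers of a substitution\<close>

text \<open>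
  Two powers of \<open>f\<close> agree on \<open>A\<close>, so the powers are eventually periodic with some period \<open>p\<close>; any
  multiple of \<open>p\<close> beyond the preperiod will do.
\<close>

lemma idempotent_power:
  assumes "finite A" "f \<in> A \<rightarrow> A"
  obtains j where "j \<ge> 1" "\<And>a. a \<in> A \<Longrightarrow> (f ^^ j) ((f ^^ j) a) = (f ^^ j) a"
proof -
  have fA: "(f ^^ n) a \<in> A" if "a \<in> A" for n a
    using assms(2) that by (induction n) auto
  have "range (\<lambda>n. restrict (f ^^ n) A) \<subseteq> A \<rightarrow>\<^sub>E A"
    using fA by auto
  moreover have "finite (A \<rightarrow>\<^sub>E A)" using assms(1) by (simp add: finite_PiE)
  ultimately have "\<not> inj (\<lambda>n. restrict (f ^^ n) A)"
    using finite_subset finite_imageD infinite_UNIV_nat by blast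
  then obtain m n where "m \<noteq> n" "restrict (f ^^ m) A = restrict (f ^^ n) A"
    by (auto simp: inj_def)
  then obtain m n where mn: "m < n" "restrict (f ^^ m) A = restrict (f ^^ n) A"
    by (metis linorder_neqE_nat)
  define p where "p = n - m"
  have per: "(f ^^ (m + p)) a = (f ^^ m) a" if "a \<in> A" for a
    using mn that by (metis less_imp_le_nat le_add_diff_inverse p_def restrict_apply')
  have per1: "(f ^^ (i + p)) a = (f ^^ i) a" if "a \<in> A" "i \<ge> m" for a i
  proof -
    have "(f ^^ (i + p)) a = (f ^^ (m + p)) ((f ^^ (i - m)) a)"
      using that(2) funpow_split[of "m + p" "i + p" f a] by simp
    also have "\<dots> = (f ^^ m) ((f ^^ (i - m)) a)" using per fA that(1) by blast
    also have "\<dots> = (f ^^ i) a" using that(2) by (rule funpow_split)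
    finally show ?thesis .
  qed
  have perk: "(f ^^ (i + p * k)) a = (f ^^ i) a" if "a \<in> A" "i \<ge> m" for a i k
  proof (induction k)
    case (Suc k)
    then show ?case using per1[of a "i + p * k"] that by (simp add: ac_simps)
  qed simp
  have "p \<ge> 1" using mn(1) by (simp add: p_def)
  then have "m \<le> p * (m + 1)" by (cases p) auto
  then have "(f ^^ (p * (m + 1))) ((f ^^ (p * (m + 1))) a) = (f ^^ (p * (m + 1))) a" if "a \<in> A" for a
    using perk[OF that, of "p * (m + 1)" "m + 1"] by (simp only: funpow_add comp_apply)
  moreover have "p * (m + 1) \<ge> 1" using \<open>p \<ge> 1\<close> by simp
  ultimately show thesis using that by blast
qed

context prim_subst
begin

lemma tau_Nil [simp]: "\<tau> [] = []"
  using pow_Nil[of 1] by simp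

lemma hd_last_image:
  assumes "w \<in> lists A" "w \<noteq> []"
  shows "hd (\<tau> w) = hd (\<tau> [hd w])" "last (\<tau> w) = last (\<tau> [last w])"
proof -
  obtain b v where "w = b # v" "b \<in> A" "v \<in> lists A" using assms by (cases w) auto
  then show "hd (\<tau> w) = hd (\<tau> [hd w])"
    using pow_Cons[of b v 1] nonerasing by simp
  obtain v b where "w = v @ [b]" "b \<in> A" "v \<in> lists A" using assms by (cases w rule: rev_cases) auto
  then show "last (\<tau> w) = last (\<tau> [last w])"
    using pow_append[of v "[b]" 1] nonerasing by simp
qed

lemma hd_last_pow_letter:
  assumes "a \<in> A"
  shows "hd ((\<tau> ^^ n) [a]) = ((\<lambda>b. hd (\<tau> [b])) ^^ n) a"
    and "last ((\<tau> ^^ n) [a]) = ((\<lambda>b. last (\<tau> [b])) ^^ n) a"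
proof -
  have "hd ((\<tau> ^^ n) [a]) = ((\<lambda>b. hd (\<tau> [b])) ^^ n) a \<and>
        last ((\<tau> ^^ n) [a]) = ((\<lambda>b. last (\<tau> [b])) ^^ n) a"
  proof (induction n)
    case (Suc n)
    then show ?case
      using hd_last_image[of "(\<tau> ^^ n) [a]"] pow_lists[of "[a]" n] pow_letter_neq_Nil[of a n] assms by simp
  qed simp
  then show "hd ((\<tau> ^^ n) [a]) = ((\<lambda>b. hd (\<tau> [b])) ^^ n) a"
    and "last ((\<tau> ^^ n) [a]) = ((\<lambda>b. last (\<tau> [b])) ^^ n) a" by auto
qed

lemma letters_of_word: "w \<in> lists A \<Longrightarrow> w \<noteq> [] \<Longrightarrow> hd w \<in> A \<and> last w \<in> A"
  by (meson in_listsD hd_in_set last_in_set)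

lemma hd_last_in_A:
  assumes "a \<in> A"
  shows "hd ((\<tau> ^^ n) [a]) \<in> A" "last ((\<tau> ^^ n) [a]) \<in> A"
  using letters_of_word[of "(\<tau> ^^ n) [a]"] pow_lists pow_letter_neq_Nil assms by auto

end

text \<open>
  The maps taking \<open>a\<close> to the first and to the last letter of \<open>\<tau>(a)\<close> are idempotent. Then \<open>\<tau>\<^sup>n(w)\<close> has
  the same beginning and the same end, on longer and longer stretches, for all large \<open>n\<close>.
\<close>

locale fixed_ends = prim_subst +
  assumes hd_fixed: "a \<in> A \<Longrightarrow> hd (\<tau> [hd (\<tau> [a])]) = hd (\<tau> [a])"
    and last_fixed: "a \<in> A \<Longrightarrow> last (\<tau> [last (\<tau> [a])]) = last (\<tau> [a])"

lemma (in prim_subst) some_power_fixed_ends: "\<exists>N\<ge>1. fixed_ends A (\<tau> ^^ N)"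
proof -
  let ?f = "\<lambda>b. hd (\<tau> [b])" and ?g = "\<lambda>b. last (\<tau> [b])"
  \<comment> \<open>The product map makes both letter maps idempotent with the same exponent.\<close>
  have "map_prod ?f ?g \<in> A \<times> A \<rightarrow> A \<times> A"
    using hd_last_in_A[of _ 1] by auto
  then obtain j where j: "j \<ge> 1"
    "\<And>x. x \<in> A \<times> A \<Longrightarrow> (map_prod ?f ?g ^^ j) ((map_prod ?f ?g ^^ j) x) = (map_prod ?f ?g ^^ j) x"
    using idempotent_power[of "A \<times> A" "map_prod ?f ?g"] finA by blast
  have "(map_prod ?f ?g ^^ n) (a, b) = ((?f ^^ n) a, (?g ^^ n) b)" for n a b
    by (induction n) auto
  then have idem: "(?f ^^ j) ((?f ^^ j) a) = (?f ^^ j) a" "(?g ^^ j) ((?g ^^ j) a) = (?g ^^ j) a"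
    if "a \<in> A" for a using j(2)[of "(a, a)"] that by auto
  interpret P: prim_subst A "\<tau> ^^ j" by (rule prim_subst_pow[OF j(1)])
  have "fixed_ends A (\<tau> ^^ j)"
  proof
    fix a assume a: "a \<in> A"
    note f = hd_last_pow_letter[of _ j] and inA = hd_last_in_A[OF a, of j]
    show "hd ((\<tau> ^^ j) [hd ((\<tau> ^^ j) [a])]) = hd ((\<tau> ^^ j) [a])"
      unfolding f(1)[OF inA(1)] unfolding f(1)[OF a] by (rule idem(1)[OF a])
    show "last ((\<tau> ^^ j) [last ((\<tau> ^^ j) [a])]) = last ((\<tau> ^^ j) [a])"
      unfolding f(2)[OF inA(2)] unfolding f(2)[OF a] by (rule idem(2)[OF a])
  qed
  then show ?thesis using j(1) by blast
qed

context fixed_ends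
begin

lemma hd_last_pow:
  assumes "a \<in> A" "n \<ge> 1"
  shows "hd ((\<tau> ^^ n) [a]) = hd (\<tau> [a])" "last ((\<tau> ^^ n) [a]) = last (\<tau> [a])"
proof -
  have "hd ((\<tau> ^^ n) [a]) = hd (\<tau> [a]) \<and> last ((\<tau> ^^ n) [a]) = last (\<tau> [a])"
    using assms(2)
  proof (induction n rule: nat_induct_at_least)
    case (Suc n)
    then show ?case
      using hd_last_image[of "(\<tau> ^^ n) [a]"] pow_lists pow_letter_neq_Nil assms(1) hd_fixed last_fixed by simp
  qed simp
  then show "hd ((\<tau> ^^ n) [a]) = hd (\<tau> [a])" "last ((\<tau> ^^ n) [a]) = last (\<tau> [a])" by auto
qed

text \<open>
  The word \<open>\<tau>\<^bsup>m-n\<^esup>(hd w)\<close> starts with a letter that is independent of \<open>m\<close>; apply \<open>\<tau>\<^sup>n\<close> to it.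
\<close>

lemma stable_prefix:
  assumes "w \<in> lists A" "w \<noteq> []" "n < m"
  shows "prefix ((\<tau> ^^ n) [hd (\<tau> [hd w])]) ((\<tau> ^^ m) w)"
proof -
  let ?v = "(\<tau> ^^ (m - n)) [hd w]"
  have hw: "hd w \<in> A" "tl w \<in> lists A" using assms letters_of_word by (auto dest: list.set_sel)
  have v: "?v \<in> lists A" "?v \<noteq> []" "hd ?v = hd (\<tau> [hd w])"
    using hw pow_lists pow_letter_neq_Nil hd_last_pow[of "hd w" "m - n"] assms(3) by simp_all
  then obtain v' where v': "?v = hd (\<tau> [hd w]) # v'" "hd (\<tau> [hd w]) \<in> A" "v' \<in> lists A"
    by (cases ?v) auto
  have "(\<tau> ^^ m) [hd w] = (\<tau> ^^ n) ?v"
    using assms(3) by (simp add: funpow_split)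
  also have "\<dots> = (\<tau> ^^ n) [hd (\<tau> [hd w])] @ (\<tau> ^^ n) v'"
    using pow_Cons v' by metis
  finally have "(\<tau> ^^ m) w = (\<tau> ^^ n) [hd (\<tau> [hd w])] @ (\<tau> ^^ n) v' @ (\<tau> ^^ m) (tl w)"
    using pow_Cons[OF hw, of m] assms(2) by simp
  then show ?thesis by simp
qed

lemma stable_suffix:
  assumes "w \<in> lists A" "w \<noteq> []" "n < m"
  shows "suffix ((\<tau> ^^ n) [last (\<tau> [last w])]) ((\<tau> ^^ m) w)"
proof -
  let ?v = "(\<tau> ^^ (m - n)) [last w]"
  have hw: "last w \<in> A" "butlast w \<in> lists A"
    using assms letters_of_word by (auto dest: in_set_butlastD)
  have v: "?v \<in> lists A" "?v \<noteq> []" "last ?v = last (\<tau> [last w])"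
    using hw pow_lists pow_letter_neq_Nil hd_last_pow[of "last w" "m - n"] assms(3) by simp_all
  then obtain v' where v': "?v = v' @ [last (\<tau> [last w])]" "last (\<tau> [last w]) \<in> A" "v' \<in> lists A"
    by (cases ?v rule: rev_cases) auto
  have "(\<tau> ^^ m) [last w] = (\<tau> ^^ n) ?v"
    using assms(3) by (simp add: funpow_split)
  also have "\<dots> = (\<tau> ^^ n) v' @ (\<tau> ^^ n) [last (\<tau> [last w])]"
    using pow_append[of v' "[last (\<tau> [last w])]" n] v' by simp
  finally have "(\<tau> ^^ m) w = ((\<tau> ^^ m) (butlast w) @ (\<tau> ^^ n) v') @ (\<tau> ^^ n) [last (\<tau> [last w])]"
    using pow_append[of "butlast w" "[last w]" m] assms(2) hw by simp
  then show ?thesis by (metis suffixI)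
qed

text \<open>
  Extend \<open>u\<close> to a factor \<open>l u r\<close>. By stability of prefixes and suffixes, the ends of \<open>\<tau>\<^sup>n(u)\<close> inside
  \<open>\<tau>\<^sup>n(l u r)\<close> have the same context for all large \<open>n\<close>. How large depends only on the length of the
  context, hence not on \<open>u\<close>.
\<close>

lemma scaled_lengths_uniformly_Cauchy:
  assumes ev: "eigenvalue A (subst_subshift A \<tau>) \<alpha>" and \<epsilon>: "0 < \<epsilon>"
  obtains n0 where "\<And>n m u. \<lbrakk>n \<ge> n0; m \<ge> n0; u \<in> factors A \<tau>\<rbrakk> \<Longrightarrow>
    dist_int (\<alpha> * real (length ((\<tau> ^^ n) u)) - \<alpha> * real (length ((\<tau> ^^ m) u))) < \<epsilon>"
proof (rule length_determined_by_contexts[OF ev \<epsilon>])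
  fix R
  assume R: "\<And>x u y x' u' y' p s p' s'. \<lbrakk>x @ u @ y \<in> factors A \<tau>; x' @ u' @ y' \<in> factors A \<tau>;
       suffix p x; suffix p x'; prefix s (u @ y); prefix s (u' @ y');
       suffix p' (x @ u); suffix p' (x' @ u'); prefix s' y; prefix s' y';
       R \<le> length p; R \<le> length s; R \<le> length p'; R \<le> length s'\<rbrakk>
     \<Longrightarrow> dist_int (\<alpha> * real (length u) - \<alpha> * real (length u')) < \<epsilon>"
  obtain n1 where n1: "\<And>b. b \<in> A \<Longrightarrow> R \<le> length ((\<tau> ^^ n1) [b])"
    using lengths_unbounded by blast
  show thesis
  proof (rule that[of "n1 + 1"])
    fix n m u assume nm: "n \<ge> n1 + 1" "m \<ge> n1 + 1" and u: "u \<in> factors A \<tau>"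
    obtain l r where lr: "l # u @ [r] \<in> factors A \<tau>" using factor_extends[OF u] by blast
    then have inA: "l \<in> A" "r \<in> A" "u \<in> lists A" using factors_in_lists[OF lr] by simp_all
    have fac: "(\<tau> ^^ k) [l] @ (\<tau> ^^ k) u @ (\<tau> ^^ k) [r] \<in> factors A \<tau>" for k
      using pow_in_factors[OF lr, of k] pow_Cons[of l "u @ [r]" k] pow_append[of u "[r]" k] inA by simp
    have app: "(\<tau> ^^ k) (u @ [r]) = (\<tau> ^^ k) u @ (\<tau> ^^ k) [r]"
       "(\<tau> ^^ k) (l # u) = (\<tau> ^^ k) [l] @ (\<tau> ^^ k) u" for k
      using pow_Cons[of l u k] pow_append[of u "[r]" k] inA by simp_all
    have k: "n1 < n" "n1 < m" using nm by auto
    have letters: "hd (\<tau> [hd (u @ [r])]) \<in> A" "last (\<tau> [last (l # u)]) \<in> A"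
       "hd (\<tau> [r]) \<in> A" "last (\<tau> [l]) \<in> A"
      using hd_last_in_A[of _ 1] letters_of_word[of "u @ [r]"] letters_of_word[of "l # u"] inA by auto
    show "dist_int (\<alpha> * real (length ((\<tau> ^^ n) u)) - \<alpha> * real (length ((\<tau> ^^ m) u))) < \<epsilon>"
    proof (rule R[OF fac[of n] fac[of m]])
      show "suffix ((\<tau> ^^ n1) [last (\<tau> [l])]) ((\<tau> ^^ n) [l])"
        "suffix ((\<tau> ^^ n1) [last (\<tau> [l])]) ((\<tau> ^^ m) [l])"
        using stable_suffix[of "[l]"] k inA by simp_all
      show "prefix ((\<tau> ^^ n1) [hd (\<tau> [r])]) ((\<tau> ^^ n) [r])"
        "prefix ((\<tau> ^^ n1) [hd (\<tau> [r])]) ((\<tau> ^^ m) [r])"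
        using stable_prefix[of "[r]"] k inA by simp_all
      show "suffix ((\<tau> ^^ n1) [last (\<tau> [last (l # u)])]) ((\<tau> ^^ n) [l] @ (\<tau> ^^ n) u)"
        "suffix ((\<tau> ^^ n1) [last (\<tau> [last (l # u)])]) ((\<tau> ^^ m) [l] @ (\<tau> ^^ m) u)"
        using stable_suffix[of "l # u"] k inA unfolding app[symmetric] by simp_all
      show "prefix ((\<tau> ^^ n1) [hd (\<tau> [hd (u @ [r])])]) ((\<tau> ^^ n) u @ (\<tau> ^^ n) [r])"
        "prefix ((\<tau> ^^ n1) [hd (\<tau> [hd (u @ [r])])]) ((\<tau> ^^ m) u @ (\<tau> ^^ m) [r])"
        using stable_prefix[of "u @ [r]"] k inA unfolding app[symmetric] by simp_all
    qed (use n1 letters in auto)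
  qed
qed

text \<open>
  If no letter has scaled lengths bounded away from the integers, then for every letter they come close
  to the integers infinitely often, hence tend to 0 modulo 1 by the Cauchy property. Subadditivity
  carries this over to each word, and the uniformity in the Cauchy property makes the convergence
  uniform over all factors.
\<close>

lemma bounded_away_or_uniformly_null:
  assumes ev: "eigenvalue A (subst_subshift A \<tau>) \<alpha>"
  shows "(\<exists>a\<in>A. \<exists>\<epsilon>>0. \<forall>\<^sub>F n in sequentially. \<epsilon> \<le> dist_int (\<alpha> * real (length ((\<tau> ^^ n) [a])))) \<or>
    (\<forall>\<epsilon>>0. \<exists>n0. \<forall>n\<ge>n0. \<forall>u\<in>factors A \<tau>. dist_int (\<alpha> * real (length ((\<tau> ^^ n) u))) < \<epsilon>)"
    (is "?away \<or> ?null")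
proof (rule disjCI)
  assume "\<not> ?null"
  let ?d = "\<lambda>n u. dist_int (\<alpha> * real (length ((\<tau> ^^ n) u)))"
  have near: "?d n u \<le> ?d m u + dist_int (\<alpha> * real (length ((\<tau> ^^ n) u)) - \<alpha> * real (length ((\<tau> ^^ m) u)))"
    for n m u
    using dist_int_add[of "\<alpha> * real (length ((\<tau> ^^ m) u))"
      "\<alpha> * real (length ((\<tau> ^^ n) u)) - \<alpha> * real (length ((\<tau> ^^ m) u))"] by simp
  show ?away
  proof (rule ccontr)
    assume "\<not> ?away"
    then have freq: "\<exists>m\<ge>n. ?d m [a] < \<epsilon>" if "a \<in> A" "0 < \<epsilon>" for a n \<epsilon>
      using that by (auto simp: eventually_sequentially not_le)
    have letter: "\<exists>n0. \<forall>n\<ge>n0. ?d n [a] < \<epsilon>" if a: "a \<in> A" and \<epsilon>: "0 < \<epsilon>" for a \<epsilon>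
    proof -
      obtain n0 where n0: "\<And>n m. n \<ge> n0 \<Longrightarrow> m \<ge> n0 \<Longrightarrow>
          dist_int (\<alpha> * real (length ((\<tau> ^^ n) [a])) - \<alpha> * real (length ((\<tau> ^^ m) [a]))) < \<epsilon> / 2"
        using scaled_lengths_uniformly_Cauchy[OF ev, of "\<epsilon> / 2"] \<epsilon> singleton_in_factors[OF a]
        by (metis half_gt_zero)
      obtain m where m: "m \<ge> n0" "?d m [a] < \<epsilon> / 2"
        using freq[OF a, of "\<epsilon> / 2" n0] \<epsilon> by auto
      have "?d n [a] < \<epsilon>" if "n \<ge> n0" for n
        using near[of n "[a]" m] n0[OF that m(1)] m(2) by simp
      then show ?thesis by blast
    qed
    have word: "\<exists>n0. \<forall>n\<ge>n0. ?d n u < \<epsilon>" if "u \<in> lists A" "0 < \<epsilon>" for u \<epsilon>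
      using that
    proof (induction u arbitrary: \<epsilon>)
      case Nil
      then show ?case by (simp add: infdist_zero)
    next
      case (Cons a u)
      obtain n1 where n1: "\<And>n. n \<ge> n1 \<Longrightarrow> ?d n [a] < \<epsilon> / 2"
        using letter[of a "\<epsilon> / 2"] Cons.hyps Cons.prems by auto
      obtain n2 where n2: "\<And>n. n \<ge> n2 \<Longrightarrow> ?d n u < \<epsilon> / 2"
        using Cons.IH[of "\<epsilon> / 2"] Cons.prems by auto
      have "?d n (a # u) < \<epsilon>" if "n \<ge> max n1 n2" for n
      proof -
        have "real (length ((\<tau> ^^ n) (a # u))) =
            real (length ((\<tau> ^^ n) [a])) + real (length ((\<tau> ^^ n) u))"
          using pow_Cons[of a u n] Cons.hyps by simp
        then have "?d n (a # u) \<le> ?d n [a] + ?d n u"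
          by (simp add: distrib_left dist_int_add)
        then show ?thesis using n1[of n] n2[of n] that by simp
      qed
      then show ?case by blast
    qed
    have ?null
    proof (intro allI impI)
      fix \<epsilon> :: real assume \<epsilon>: "0 < \<epsilon>"
      obtain n0 where n0: "\<And>n m u. n \<ge> n0 \<Longrightarrow> m \<ge> n0 \<Longrightarrow> u \<in> factors A \<tau> \<Longrightarrow>
          dist_int (\<alpha> * real (length ((\<tau> ^^ n) u)) - \<alpha> * real (length ((\<tau> ^^ m) u))) < \<epsilon> / 2"
        using scaled_lengths_uniformly_Cauchy[OF ev, of "\<epsilon> / 2"] \<epsilon> by (metis half_gt_zero)
      have "?d n u < \<epsilon>" if n: "n \<ge> n0" and u: "u \<in> factors A \<tau>" for n u
      proof -
        obtain m where m: "m \<ge> n0" "?d m u < \<epsilon> / 2"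
          using word[OF factors_in_lists[OF u], of "\<epsilon> / 2"] \<epsilon> by (metis half_gt_zero nle_le)
        show ?thesis using near[of n u m] n0[OF n m(1) u] m(2) by simp
      qed
      then show "\<exists>n0. \<forall>n\<ge>n0. \<forall>u\<in>factors A \<tau>. ?d n u < \<epsilon>" by blast
    qed
    then show False using \<open>\<not> ?null\<close> by blast
  qed
qed

end

section \<open>Two-block codes with shifted cuts\<close>

definition two_block :: "('a \<times> 'a \<Rightarrow> 'b) \<Rightarrow> 'a list \<Rightarrow> 'b list" where
  "two_block e w = map e (zip w (tl w))"

lemma two_block_simps [simp]:
  "two_block e [] = []" "two_block e [a] = []"
  "two_block e (a # b # w) = e (a, b) # two_block e (b # w)"
  by (simp_all add: two_block_def)

lemma length_two_block [simp]: "length (two_block e w) = length w - 1"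
  by (simp add: two_block_def)

text \<open>
  Concatenation of codes corresponds to gluing words along a common letter.
\<close>

lemma two_block_append:
  "two_block e (u @ x # v) = two_block e (u @ [x]) @ two_block e (x # v)"
proof (induction u)
  case (Cons a u)
  then show ?case by (cases u) auto
qed simp

lemma sublist_two_block:
  assumes "sublist u w"
  shows "sublist (two_block e u) (two_block e w)"
proof (cases u)
  case (Cons a u')
  obtain p q where w: "w = p @ u @ q" using assms by (auto simp: sublist_def)
  obtain u'' b where u: "u = u'' @ [b]" using Cons by (metis list.discI rev_exhaust)
  have "two_block e w = two_block e (p @ [a]) @ two_block e (u @ q)"
    using two_block_append[of e p a "u' @ q"] by (simp add: w Cons)
  also have "two_block e (u @ q) = two_block e u @ two_block e (b # q)"
    using two_block_append[of e u'' b q] by (simp add: u)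
  finally show ?thesis by simp
qed simp

lemma pair_in_zip_tl: "(b, c) \<in> set (zip w (tl w)) \<Longrightarrow> sublist [b, c] w"
proof (induction w)
  case (Cons a w)
  then show ?case
  proof (cases w)
    case (Cons d v)
    then have "(b, c) = (a, d) \<or> (b, c) \<in> set (zip w (tl w))"
      using Cons.prems by auto
    then show ?thesis
      using Cons.IH Cons by (auto simp: sublist_Cons_right[of _ a])
  qed simp
qed simp

lemma map_fst_two_block:
  assumes "\<And>b c. sublist [b, c] w \<Longrightarrow> d (e (b, c)) = (b, c)"
  shows "map (\<lambda>i. fst (d i)) (two_block e w) = butlast w"
proof -
  have "map (\<lambda>i. fst (d i)) (two_block e w) = map fst (zip w (tl w))"
    unfolding two_block_def map_map
    by (rule map_cong) (use assms pair_in_zip_tl in force)+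
  also have "\<dots> = butlast w"
    by (simp add: map_fst_zip_take butlast_conv_take)
  finally show ?thesis .
qed

text \<open>
  The shift \<open>s a\<close> is the number of letters by which the cut in front of \<open>\<tau>(a)\<close> is moved to the right. At
  least two letters of \<open>\<tau>(a)\<close> remain behind the new cut, so that the recoded substitution at least
  doubles the number of two-letter blocks. The injection \<open>e\<close> only names these blocks by numbers.
\<close>

locale cut_shift = prim_subst +
  fixes s :: "'a \<Rightarrow> nat" and e :: "'a \<times> 'a \<Rightarrow> nat"
  assumes inj_e: "inj_on e (A \<times> A)"
    and long: "a \<in> A \<Longrightarrow> s a + 2 \<le> length (\<tau> [a])"
begin

text \<open>
  The part of the image of \<open>w\<close> from the shifted cut of its first letter up to and including the letter
  behind the shifted cut of its last letter. This last letter is included so that the two-block code of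
  \<open>cut w\<close> covers exactly the positions between the two shifted cuts.
\<close>

definition cut :: "'a list \<Rightarrow> 'a list" where
  "cut w = drop (s (hd w)) (\<tau> (butlast w) @ take (s (last w) + 1) (\<tau> [last w]))"

definition cut_letter :: "'a \<Rightarrow> 'a" where
  "cut_letter b = \<tau> [b] ! s b"

definition dec :: "nat \<Rightarrow> 'a \<times> 'a" where
  "dec = inv_into (A \<times> A) e"

definition pairs :: "nat set" where
  "pairs = e ` {(b, c). [b, c] \<in> factors A \<tau>}"

definition sigma :: "nat list \<Rightarrow> nat list" where
  "sigma v = concat (map (\<lambda>i. two_block e (cut [fst (dec i), snd (dec i)])) v)"

lemma dec_e: "b \<in> A \<Longrightarrow> c \<in> A \<Longrightarrow> dec (e (b, c)) = (b, c)"
  unfolding dec_def using inj_e by (simp add: inv_into_f_f)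

lemma tau_append: "u \<in> lists A \<Longrightarrow> v \<in> lists A \<Longrightarrow> \<tau> (u @ v) = \<tau> u @ \<tau> v"
  using pow_append[of u v 1] by simp

lemma cut_singleton: "b \<in> A \<Longrightarrow> cut [b] = [cut_letter b]"
  using long[of b] by (simp add: cut_def cut_letter_def take_Suc_conv_app_nth)

text \<open>
  Images of words that share a letter share the letter behind the shifted cut, so \<open>cut\<close> is compatible
  with gluing along a letter, as is the two-block code. This is what makes \<open>sigma\<close> the morphism induced
  by \<open>cut\<close>, see \<open>sigma_two_block\<close>.
\<close>

lemma cut_Cons_Cons:
  assumes "b # c # w \<in> lists A"
  shows "cut (b # c # w) = drop (s b) (\<tau> [b] @ take (s c) (\<tau> [c])) @ cut (c # w)"
proof -
  define Y where "Y = \<tau> (butlast (c # w)) @ take (s (last (c # w)) + 1) (\<tau> [last (c # w)])"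
  have inA: "b \<in> A" "c \<in> A" "w \<in> lists A" "butlast (c # w) \<in> lists A"
    using assms by (auto dest: in_set_butlastD)
  have "take (s c) Y = take (s c) (\<tau> [c])"
  proof (cases w)
    case (Cons d v)
    then have "\<tau> (butlast (c # w)) = \<tau> [c] @ \<tau> (butlast w)"
      using tau_append[of "[c]" "butlast w"] inA by simp
    then show ?thesis using long[OF inA(2)] by (simp add: Y_def)
  qed (simp add: Y_def)
  then have Y: "Y = take (s c) (\<tau> [c]) @ cut (c # w)"
    by (metis Y_def append_take_drop_id cut_def list.sel(1))
  have "\<tau> (butlast (b # c # w)) = \<tau> [b] @ \<tau> (butlast (c # w))"
    using tau_append[of "[b]" "butlast (c # w)"] inA by simp
  then have "cut (b # c # w) = drop (s b) (\<tau> [b] @ Y)"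
    by (simp add: cut_def Y_def)
  then show ?thesis
    using long[OF inA(1)] by (simp add: Y)
qed

lemma hd_last_cut:
  assumes "w \<in> lists A" "w \<noteq> []"
  shows "cut w \<noteq> [] \<and> hd (cut w) = cut_letter (hd w) \<and> last (cut w) = cut_letter (last w)"
  using assms
proof (induction w rule: induct_list012)
  case (3 b c w)
  then show ?case
    using cut_Cons_Cons[of b c w] long[of b]
    by (simp add: hd_append cut_letter_def hd_drop_conv_nth)
qed (simp_all add: cut_singleton)

lemma cut_in_factors:
  assumes "w \<in> factors A \<tau>" "w \<noteq> []"
  shows "cut w \<in> factors A \<tau>"
proof -
  have w: "w = butlast w @ [last w]" "butlast w \<in> lists A" "last w \<in> A"
    using assms(2) factors_in_lists[OF assms(1)] letters_of_word by (auto dest: in_set_butlastD)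
  have "\<tau> w = \<tau> (butlast w) @ \<tau> [last w]"
    using tau_append[of "butlast w" "[last w]"] w by simp
  then have "prefix (\<tau> (butlast w) @ take (s (last w) + 1) (\<tau> [last w])) (\<tau> w)"
    by (simp add: take_is_prefix)
  then have "sublist (cut w) (\<tau> w)"
    unfolding cut_def by (meson prefix_imp_sublist sublist_drop sublist_order.order_trans)
  moreover have "\<tau> w \<in> factors A \<tau>" using pow_in_factors[OF assms(1), of 1] by simp
  ultimately show ?thesis by (rule sublist_in_factors[rotated])
qed

lemma length_cut:
  assumes "w \<in> lists A" "w \<noteq> []"
  shows "length (cut w) + s (hd w) = length (\<tau> (butlast w)) + s (last w) + 1"
proof -
  have w: "hd w \<in> A" "last w \<in> A" "butlast w \<in> lists A"
    using assms letters_of_word by (auto dest: in_set_butlastD)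
  have "s (hd w) \<le> length (\<tau> (butlast w)) + s (last w) + 1"
  proof (cases "butlast w")
    case Nil
    then have "w = [last w]" using assms(2) by (metis append_Nil append_butlast_last_id)
    then show ?thesis by (metis le_add1 le_add2 list.sel(1) order_trans)
  next
    case (Cons b v)
    then have "b = hd w" by (metis assms(2) butlast.simps(2) list.collapse list.sel(1) list.distinct(1))
    then have "\<tau> (butlast w) = \<tau> [hd w] @ \<tau> v"
      using tau_append[of "[hd w]" v] Cons w by simp
    then show ?thesis using long[OF w(1)] by simp
  qed
  then show ?thesis using long[OF w(2)] by (simp add: cut_def)
qed

text \<open>
  Shifting affects only the ends of an image, because no cut is moved beyond the image of its letter.
\<close>

lemma cut_contains_interior:
  assumes "u @ v @ u' \<in> lists A" "u \<noteq> []" "u' \<noteq> []"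
  shows "\<exists>x x'. x \<noteq> [] \<and> x' \<noteq> [] \<and> cut (u @ v @ u') = x @ \<tau> v @ x'"
proof -
  have inA: "u \<in> lists A" "v \<in> lists A" "butlast u' \<in> lists A" "hd u \<in> A" "last u' \<in> A" "tl u \<in> lists A"
    using assms letters_of_word by (auto dest: in_set_butlastD list.set_sel)
  have "\<tau> u = \<tau> [hd u] @ \<tau> (tl u)"
    using tau_append[of "[hd u]" "tl u"] inA assms(2) by simp
  then have len: "s (hd u) < length (\<tau> u)"
    using long[OF inA(4)] by simp
  have "\<tau> (butlast (u @ v @ u')) = \<tau> u @ \<tau> v @ \<tau> (butlast u')"
    using tau_append[of u "v @ butlast u'"] tau_append[of v "butlast u'"] inA assms(3)
    by (simp add: butlast_append)
  then have "cut (u @ v @ u') =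
      drop (s (hd u)) (\<tau> u) @ \<tau> v @ \<tau> (butlast u') @ take (s (last u') + 1) (\<tau> [last u'])"
    using len assms by (simp add: cut_def)
  moreover have "take (s (last u') + 1) (\<tau> [last u']) \<noteq> []"
    using nonerasing[OF inA(5)] by simp
  ultimately show ?thesis using len by (metis append_is_Nil_conv drop_eq_Nil2 not_less)
qed

lemma cut_pow_in_factors:
  assumes "w \<in> factors A \<tau>" "w \<noteq> []"
  shows "(cut ^^ n) w \<in> factors A \<tau> \<and> (cut ^^ n) w \<noteq> [] \<and>
    hd ((cut ^^ n) w) = (cut_letter ^^ n) (hd w) \<and> last ((cut ^^ n) w) = (cut_letter ^^ n) (last w)"
  by (induction n) (auto simp: assms cut_in_factors hd_last_cut[OF factors_in_lists])

lemma cut_pow_contains_interior: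
  assumes "u @ v @ u' \<in> factors A \<tau>" "u \<noteq> []" "u' \<noteq> []"
  shows "\<exists>x x'. x \<noteq> [] \<and> x' \<noteq> [] \<and> (cut ^^ n) (u @ v @ u') = x @ (\<tau> ^^ n) v @ x'"
proof (induction n)
  case 0
  show ?case using assms by auto
next
  case (Suc n)
  then obtain x x' where x: "x \<noteq> []" "x' \<noteq> []" "(cut ^^ n) (u @ v @ u') = x @ (\<tau> ^^ n) v @ x'"
    by blast
  have "x @ (\<tau> ^^ n) v @ x' \<in> lists A"
    using cut_pow_in_factors[OF assms(1), of n] factors_in_lists assms(2) x(3) by (metis append_is_Nil_conv)
  then show ?case using cut_contains_interior[OF _ x(1,2)] by (simp add: x(3))
qed

text \<open>
  After one step there is an interior letter \<open>d\<close>, and the images of \<open>d\<close> under the unshifted powers of \<open>\<tau>\<close>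
  survive from then on. This transports recurrence, hence primitivity and the language, from \<open>\<tau>\<close> to
  \<open>sigma\<close>.
\<close>

lemma factor_in_cut_pow:
  assumes "w \<in> factors A \<tau>"
  shows "\<exists>n0. \<forall>n\<ge>n0. \<forall>b c. [b, c] \<in> factors A \<tau> \<longrightarrow> sublist w ((cut ^^ n) [b, c])"
proof -
  obtain n0 where n0: "\<And>n d. n \<ge> n0 \<Longrightarrow> d \<in> A \<Longrightarrow> sublist w ((\<tau> ^^ n) [d])"
    using factor_in_all_large_powers[OF assms] by blast
  have "sublist w ((cut ^^ n) [b, c])" if n: "n \<ge> n0 + 1" and bc: "[b, c] \<in> factors A \<tau>" for n b c
  proof -
    have inA: "b \<in> A" "c \<in> A" using factors_in_lists[OF bc] by auto
    have "3 \<le> length (cut [b, c])"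
      using length_cut[of "[b, c]"] long[OF inA(1)] inA by simp
    then obtain x d y z where cut_bc: "cut [b, c] = [x] @ [d] @ (y # z)"
      by (metis One_nat_def Suc_le_length_iff append_Cons append_Nil numeral_3_eq_3)
    have fac: "[x] @ [d] @ (y # z) \<in> factors A \<tau>"
      using cut_in_factors[OF bc] cut_bc by simp
    then have "d \<in> A" using factors_in_lists by fastforce
    have "(cut ^^ n) [b, c] = (cut ^^ (n - 1)) ([x] @ [d] @ (y # z))"
      using funpow_split[of "n - 1" n cut "[b, c]"] n cut_bc by simp
    then have "sublist ((\<tau> ^^ (n - 1)) [d]) ((cut ^^ n) [b, c])"
      using cut_pow_contains_interior[OF fac, of "n - 1"] by auto
    then show ?thesis
      using n0[of "n - 1" d] n \<open>d \<in> A\<close> by (meson add_le_imp_le_diff sublist_order.order_trans)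
  qed
  then show ?thesis by blast
qed

text \<open>
  The key relation: on codes of words, \<open>sigma\<close> acts as \<open>cut\<close> does on the words themselves.
\<close>

lemma sigma_two_block:
  assumes "w \<in> lists A" "w \<noteq> []"
  shows "sigma (two_block e w) = two_block e (cut w)"
  using assms
proof (induction w rule: induct_list012)
  case (2 b)
  then show ?case by (simp add: cut_singleton sigma_def)
next
  case (3 b c w)
  then have inA: "b \<in> A" "c \<in> A" "w \<in> lists A" by auto
  obtain t where t: "cut (c # w) = cut_letter c # t"
    using hd_last_cut[of "c # w"] inA by (metis list.collapse list.sel(1) list.discI lists.Cons)
  let ?P = "drop (s b) (\<tau> [b] @ take (s c) (\<tau> [c]))"
  have "cut [b, c] = ?P @ [cut_letter c]"
    using cut_Cons_Cons[of b c "[]"] inA by (simp add: cut_singleton)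
  then have "two_block e (cut (b # c # w)) = two_block e (cut [b, c]) @ two_block e (cut (c # w))"
    using cut_Cons_Cons[of b c w] two_block_append[of e ?P "cut_letter c" t] inA t by simp
  moreover have "sigma (two_block e (b # c # w)) = two_block e (cut [b, c]) @ sigma (two_block e (c # w))"
    using inA by (simp add: sigma_def dec_e)
  ultimately show ?case using 3 inA by simp
qed simp

lemma sigma_pow_two_block:
  assumes "w \<in> factors A \<tau>" "w \<noteq> []"
  shows "(sigma ^^ n) (two_block e w) = two_block e ((cut ^^ n) w)"
proof (induction n)
  case (Suc n)
  then show ?case
    using sigma_two_block[of "(cut ^^ n) w"] cut_pow_in_factors[OF assms, of n] factors_in_lists by simp
qed simp

lemma sigma_pow_letter: "[b, c] \<in> factors A \<tau> \<Longrightarrow> (sigma ^^ n) [e (b, c)] = two_block e ((cut ^^ n) [b, c])"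
  using sigma_pow_two_block[of "[b, c]"] by simp

lemma two_block_in_lists: "w \<in> factors A \<tau> \<Longrightarrow> two_block e w \<in> lists pairs"
  unfolding two_block_def pairs_def using pair_in_zip_tl sublist_in_factors by force

lemma finite_pairs: "finite pairs"
proof -
  have "{(b, c). [b, c] \<in> factors A \<tau>} \<subseteq> A \<times> A"
    using factors_in_lists by fastforce
  then show ?thesis unfolding pairs_def using finA finite_subset by blast
qed

lemma letter_pair: "b \<in> A \<Longrightarrow> \<exists>c. [b, c] \<in> factors A \<tau>"
  using factor_extends[OF singleton_in_factors] sublist_in_factors
  by (metis append_Cons append_Nil sublist_Cons_right sublist_order.order_refl)

lemma prim_subst_sigma: "prim_subst pairs sigma"
proof
  have card: "2 \<le> card pairs"
  proof -
    have "A \<subseteq> (\<lambda>i. fst (dec i)) ` pairs"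
    proof
      fix b assume b: "b \<in> A"
      then obtain c where c: "[b, c] \<in> factors A \<tau>" using letter_pair by blast
      then have "fst (dec (e (b, c))) = b" using factors_in_lists[OF c] by (simp add: dec_e)
      moreover have "e (b, c) \<in> pairs" using c by (auto simp: pairs_def)
      ultimately show "b \<in> (\<lambda>i. fst (dec i)) ` pairs" by force
    qed
    then have "card A \<le> card pairs" using finite_pairs by (rule surj_card_le[rotated])
    then show ?thesis using card_A by linarith
  qed
  have sig: "sigma [i] \<in> lists pairs \<and> sigma [i] \<noteq> []" if i: "i \<in> pairs" for i
  proof -
    obtain b c where bc: "i = e (b, c)" "[b, c] \<in> factors A \<tau>"
      using i by (auto simp: pairs_def)
    then have inA: "b \<in> A" "c \<in> A" using factors_in_lists[OF bc(2)] by auto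
    have "sigma [i] = two_block e (cut [b, c])"
      using sigma_pow_letter[OF bc(2), of 1] bc(1) by simp
    moreover have "2 \<le> length (cut [b, c])"
      using length_cut[of "[b, c]"] long[OF inA(1)] inA by simp
    then have "two_block e (cut [b, c]) \<noteq> []"
      using length_two_block[of e "cut [b, c]"] by (auto simp del: length_two_block)
    ultimately show ?thesis
      using two_block_in_lists[OF cut_in_factors[OF bc(2)]] by simp
  qed
  have endo: "free_monoid_endo pairs sigma"
    unfolding free_monoid_endo_def
  proof (intro conjI)
    have "sigma v \<in> lists pairs" if "v \<in> lists pairs" for v
      using that
    proof (induction v)
      case (Cons i v)
      then show ?case using sig[of i] by (simp add: sigma_def)
    qed (simp add: sigma_def)
    then show "sigma \<in> lists pairs \<rightarrow> lists pairs" by blast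
  qed (simp_all add: sigma_def)
  have "\<exists>k\<ge>1. \<forall>i\<in>pairs. \<forall>j\<in>pairs. j \<in> set ((sigma ^^ k) [i])"
  proof -
    have "\<exists>n0. \<forall>n\<ge>n0. \<forall>i\<in>pairs. j \<in> set ((sigma ^^ n) [i])" if j: "j \<in> pairs" for j
    proof -
      obtain b c where bc: "j = e (b, c)" "[b, c] \<in> factors A \<tau>" using j by (auto simp: pairs_def)
      obtain n0 where n0: "\<And>n b' c'. n \<ge> n0 \<Longrightarrow> [b', c'] \<in> factors A \<tau> \<Longrightarrow>
          sublist [b, c] ((cut ^^ n) [b', c'])"
        using factor_in_cut_pow[OF bc(2)] by blast
      have "j \<in> set ((sigma ^^ n) [i])" if "n \<ge> n0" "i \<in> pairs" for n i
      proof -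
        obtain b' c' where i: "i = e (b', c')" "[b', c'] \<in> factors A \<tau>"
          using \<open>i \<in> pairs\<close> by (auto simp: pairs_def)
        show ?thesis
          using sublist_two_block[OF n0[OF that(1) i(2)], of e] sigma_pow_letter[OF i(2), of n]
          by (simp add: i(1) bc(1) sublist_singleton_iff)
      qed
      then show ?thesis by blast
    qed
    then obtain N where N: "\<And>j n i. j \<in> pairs \<Longrightarrow> n \<ge> N j \<Longrightarrow> i \<in> pairs \<Longrightarrow> j \<in> set ((sigma ^^ n) [i])"
      by metis
    define M where "M = (\<Sum>j\<in>pairs. N j) + 1"
    have "N j \<le> M" if "j \<in> pairs" for j
      using member_le_sum[OF that, of N] finite_pairs by (simp add: M_def)
    moreover have "M \<ge> 1" by (simp add: M_def)
    ultimately show ?thesis using N by blast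
  qed
  moreover from this obtain k where k: "k \<ge> 1" "\<And>i j. i \<in> pairs \<Longrightarrow> j \<in> pairs \<Longrightarrow> j \<in> set ((sigma ^^ k) [i])"
    by blast
  have "\<exists>i\<in>pairs. j \<in> set (sigma [i])" if j: "j \<in> pairs" for j
  proof -
    interpret S: word_morphism pairs sigma by unfold_locales (rule endo)
    have "(sigma ^^ k) [j] = sigma ((sigma ^^ (k - 1)) [j])"
      using k(1) by (cases k) simp_all
    moreover have v: "(sigma ^^ (k - 1)) [j] \<in> lists pairs" using S.pow_lists[of "[j]"] j by simp
    ultimately show ?thesis
      using k(2)[OF j j] S.set_pow[OF v, of 1] v by auto
  qed
  ultimately show "primitive_substitution pairs sigma"
    using endo card finite_pairs sig by (auto simp: primitive_substitution_iff substitution_def)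
qed

lemma factors_sigma: "factors pairs sigma = two_block e ` {w \<in> factors A \<tau>. w \<noteq> []}"
proof (intro antisym subsetI)
  fix v assume "v \<in> two_block e ` {w \<in> factors A \<tau>. w \<noteq> []}"
  then obtain w where w: "w \<in> factors A \<tau>" "v = two_block e w" by blast
  obtain n0 where n0: "\<And>n b c. n \<ge> n0 \<Longrightarrow> [b, c] \<in> factors A \<tau> \<Longrightarrow> sublist w ((cut ^^ n) [b, c])"
    using factor_in_cut_pow[OF w(1)] by blast
  obtain b c where bc: "[b, c] \<in> factors A \<tau>"
    using letter_pair A_nonempty by blast
  then have "e (b, c) \<in> pairs" by (auto simp: pairs_def)
  moreover have "sublist v ((sigma ^^ (n0 + 1)) [e (b, c)])"
    unfolding sigma_pow_letter[OF bc] w(2) by (intro sublist_two_block n0 bc) simp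
  ultimately show "v \<in> factors pairs sigma" unfolding factors_def by force
next
  fix v assume "v \<in> factors pairs sigma"
  then obtain n i where ni: "i \<in> pairs" "sublist v ((sigma ^^ n) [i])" by (auto simp: factors_def)
  obtain b c where i: "i = e (b, c)" "[b, c] \<in> factors A \<tau>" using ni(1) by (auto simp: pairs_def)
  obtain p q where pq: "two_block e ((cut ^^ n) [b, c]) = p @ v @ q"
    using ni(2) sigma_pow_letter[OF i(2)] i(1) by (auto simp: sublist_def)
  have fac: "(cut ^^ n) [b, c] \<in> factors A \<tau>" "(cut ^^ n) [b, c] \<noteq> []"
    using cut_pow_in_factors[OF i(2)] by auto
  \<comment> \<open>Cutting \<open>l\<close> codes out of the code of \<open>w\<close> amounts to cutting \<open>l + 1\<close> letters out of \<open>w\<close>.\<close>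
  let ?u = "take (length v + 1) (drop (length p) ((cut ^^ n) [b, c]))"
  have len: "length ((cut ^^ n) [b, c]) = length p + length v + length q + 1"
    using arg_cong[OF pq, of length] fac(2) by (cases "(cut ^^ n) [b, c]") auto
  have "two_block e ?u = v"
  proof (rule nth_equalityI)
    show "length (two_block e ?u) = length v" using len by simp
    fix k assume "k < length (two_block e ?u)"
    then have k: "k < length v" using len by simp
    have nth: "two_block e w ! i = e (w ! i, w ! Suc i)" if "Suc i < length w" for w i
      using that by (simp add: two_block_def nth_tl)
    have "two_block e ?u ! k = two_block e ((cut ^^ n) [b, c]) ! (length p + k)"
      using k len by (simp add: nth)
    then show "two_block e ?u ! k = v ! k" using k by (simp add: pq nth_append)
  qed
  moreover have "?u \<in> factors A \<tau>"
    using sublist_in_factors[OF fac(1)] by (meson sublist_drop sublist_order.order_trans sublist_take)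
  moreover have "?u \<noteq> []" using len by simp
  ultimately show "v \<in> two_block e ` {w \<in> factors A \<tau>. w \<noteq> []}" by (intro image_eqI[of _ _ ?u]) auto
qed

text \<open>
  The conjugacy takes the first letter of each two-letter block; its inverse is the two-block code.
\<close>

lemma conjugate_sigma:
  "conjugate_subshifts pairs (subst_subshift pairs sigma) A (subst_subshift A \<tau>)"
proof -
  let ?X = "subst_subshift A \<tau>" and ?Y = "subst_subshift pairs sigma"
  define f where "f = (\<lambda>y (k::int). fst (dec (y k)))"
  define g where "g = (\<lambda>x (k::int). e (x k, x (k + 1)))"
  have sub: "?X \<subseteq> UNIV \<rightarrow> A" "?Y \<subseteq> UNIV \<rightarrow> pairs" by (auto simp: subst_subshift_def)
  have map_g: "map (g x) [i..j] = two_block e (map x [i..j + 1])" for x i j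
    by (rule nth_equalityI) (auto simp: nth_upto g_def two_block_def nth_tl algebra_simps)
  have gX: "g x \<in> ?Y" if x: "x \<in> ?X" for x
  proof -
    have "map (g x) [i..j] \<in> factors pairs sigma" for i j
    proof (cases "i \<le> j")
      case True
      have "map x [i..j + 1] \<in> factors A \<tau>" using x by (simp only: subst_subshift_iff_factors)
      moreover have "map x [i..j + 1] \<noteq> []" using True by simp
      ultimately show ?thesis
        unfolding map_g factors_sigma by blast
    next
      case False
      have "e (x 0, x 1) \<in> pairs"
      proof -
        have "map x [0..1] \<in> factors A \<tau>" using x by (simp only: subst_subshift_iff_factors)
        moreover have "[0..1::int] = [0, 1]" by (simp add: upto.simps)
        ultimately show ?thesis by (auto simp: pairs_def)
      qed
      then have "[] \<in> factors pairs sigma"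
        using sublist_in_factors[OF prim_subst.singleton_in_factors[OF prim_subst_sigma]] by blast
      then show ?thesis using False by simp
    qed
    moreover from this have "range (g x) \<subseteq> pairs"
    proof -
      have "g x k \<in> pairs" for k
      proof -
        have "map (g x) [k..k] \<in> lists pairs"
          using \<open>\<And>j i. map (g x) [i..j] \<in> factors pairs sigma\<close>
            prim_subst.factors_in_lists[OF prim_subst_sigma] by blast
        then show ?thesis by simp
      qed
      then show ?thesis by blast
    qed
    ultimately show ?thesis by (simp only: subst_subshift_iff_factors) blast
  qed
  have factor_Y: "\<exists>w\<in>factors A \<tau>. map y [i..j] = two_block e w \<and> butlast w = map (f y) [i..j]"
    if y: "y \<in> ?Y" for y i j
  proof -
    have "map y [i..j] \<in> factors pairs sigma" using y by (simp only: subst_subshift_iff_factors)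
    then obtain w where w: "w \<in> factors A \<tau>" "map y [i..j] = two_block e w"
      unfolding factors_sigma by blast
    have "dec (e (b, c)) = (b, c)" if "sublist [b, c] w" for b c
      using dec_e factors_in_lists[OF sublist_in_factors[OF w(1) that]] by simp
    then have "map (\<lambda>i. fst (dec i)) (two_block e w) = butlast w"
      by (rule map_fst_two_block)
    then have "butlast w = map (f y) [i..j]"
      by (simp add: f_def comp_def flip: w(2))
    then show ?thesis using w by blast
  qed
  have fY: "f y \<in> ?X" if y: "y \<in> ?Y" for y
  proof -
    have fac: "map (f y) [i..j] \<in> factors A \<tau>" for i j
      using factor_Y[OF y] sublist_in_factors sublist_butlast by metis
    have "f y k \<in> A" for k using factors_in_lists[OF fac[of k k]] by simp
    then show ?thesis using fac by (auto simp only: subst_subshift_iff_factors)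
  qed
  have fg: "f (g x) = x" if "x \<in> ?X" for x
  proof -
    have "x k \<in> A" for k using that sub(1) by blast
    then show ?thesis by (simp add: f_def g_def dec_e)
  qed
  have gf: "g (f y) = y" if y: "y \<in> ?Y" for y
  proof
    fix k
    obtain w where w: "w \<in> factors A \<tau>" "map y [k..k + 1] = two_block e w" "butlast w = map (f y) [k..k + 1]"
      using factor_Y[OF y] by blast
    have "[k..k + 1] = [k, k + 1]" by (simp add: upto.simps)
    moreover from this have "length w = 3" using arg_cong[OF w(2), of length] by simp
    moreover from this obtain a b c where "w = [a, b, c]"
      by (auto simp: numeral_3_eq_3 length_Suc_conv)
    ultimately show "g (f y) k = y k" using w(2,3) by (simp add: g_def)
  qed
  have "continuous_map (subshift_topology pairs ?Y) (subshift_topology A ?X) f"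
  proof (rule continuous_map_locally_determined[OF sub(2,1)])
    fix k :: int
    show "\<exists>K. finite K \<and> (\<forall>x\<in>?Y. \<forall>y\<in>?Y. (\<forall>k\<in>K. x k = y k) \<longrightarrow> f x k = f y k)"
      by (rule exI[of _ "{k}"]) (simp add: f_def)
  qed (use fY in auto)
  moreover have "continuous_map (subshift_topology A ?X) (subshift_topology pairs ?Y) g"
  proof (rule continuous_map_locally_determined[OF sub])
    fix k :: int
    show "\<exists>K. finite K \<and> (\<forall>x\<in>?X. \<forall>y\<in>?X. (\<forall>k\<in>K. x k = y k) \<longrightarrow> g x k = g y k)"
      by (rule exI[of _ "{k, k + 1}"]) (simp add: g_def)
  qed (use gX in auto)
  ultimately have "homeomorphic_maps (subshift_topology pairs ?Y) (subshift_topology A ?X) f g"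
    using fg gf by (simp add: homeomorphic_maps_def topspace_subshift_topology[OF sub(1)] topspace_subshift_topology[OF sub(2)])
  then have "homeomorphic_map (subshift_topology pairs ?Y) (subshift_topology A ?X) f"
    using homeomorphic_map_maps by blast
  moreover have "f (shift y) = shift (f y)" for y
    by (simp add: f_def shift_def)
  ultimately show ?thesis unfolding conjugate_subshifts_def by blast
qed

text \<open>
  Only the last step of the iteration is unfolded. All earlier shifts are hidden in the factor \<open>u\<close>, for
  which nothing but a bound that is uniform over all factors will be needed.
\<close>

lemma length_sigma_pow_Suc:
  assumes bc: "[b, c] \<in> factors A \<tau>"
  shows "\<exists>u\<in>factors A \<tau>. length ((sigma ^^ Suc n) [e (b, c)]) + s ((cut_letter ^^ n) b) =
    length (\<tau> u) + s ((cut_letter ^^ n) c)"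
proof -
  let ?w = "(cut ^^ n) [b, c]"
  have w: "?w \<in> factors A \<tau>" "?w \<noteq> []" "hd ?w = (cut_letter ^^ n) b" "last ?w = (cut_letter ^^ n) c"
    using cut_pow_in_factors[OF bc, of n] by auto
  have "length (cut ?w) + s ((cut_letter ^^ n) b) = length (\<tau> (butlast ?w)) + s ((cut_letter ^^ n) c) + 1"
    using length_cut[OF factors_in_lists[OF w(1)] w(2)] w(3,4) by simp
  moreover have "length ((sigma ^^ Suc n) [e (b, c)]) + 1 = length (cut ?w)"
    using sigma_pow_letter[OF bc, of "Suc n"] cut_pow_in_factors[OF bc, of "Suc n"] by simp
  ultimately have "length ((sigma ^^ Suc n) [e (b, c)]) + s ((cut_letter ^^ n) b) =
      length (\<tau> (butlast ?w)) + s ((cut_letter ^^ n) c)"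
    by linarith
  moreover have "butlast ?w \<in> factors A \<tau>" using sublist_in_factors[OF w(1)] sublist_butlast by blast
  ultimately show ?thesis by blast
qed

lemma length_sigma_pow_no_shift:
  assumes bc: "[b, c] \<in> factors A \<tau>" and s: "\<And>a. s a = 0"
  shows "length ((sigma ^^ n) [e (b, c)]) = length ((\<tau> ^^ n) [b])"
proof -
  have "(cut ^^ n) [b, c] \<noteq> [] \<and> butlast ((cut ^^ n) [b, c]) = (\<tau> ^^ n) [b]"
  proof (induction n)
    case (Suc n)
    let ?w = "(cut ^^ n) [b, c]"
    have w: "?w \<in> lists A" "?w \<noteq> []"
      using cut_pow_in_factors[OF bc, of n] factors_in_lists by auto
    have "\<tau> [last ?w] \<noteq> []" using nonerasing letters_of_word w by blast
    then have "cut ?w = \<tau> (butlast ?w) @ [hd (\<tau> [last ?w])]"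
      by (simp add: cut_def s take_Suc)
    then show ?case using Suc by simp
  qed simp
  then show ?thesis
    using sigma_pow_letter[OF bc, of n] by (metis length_butlast length_two_block)
qed

end

section \<open>Keeping the scaled lengths away from the integers\<close>

lemma trivial_coboundary_vanishes:
  assumes c: "letter_coboundary B X c" "trivial_coboundary B c" and w: "w \<in> lists B"
  shows "c w = 0"
  using w
proof (induction w)
  case Nil
  then show ?case using c(1) by (simp add: letter_coboundary_def)
next
  case (Cons b w)
  then have "c ([b] @ w) = c [b] + c w"
    using c(1) unfolding letter_coboundary_def by (metis lists.Cons lists.Nil)
  then show ?case using Cons c(2) by (simp add: trivial_coboundary_def)
qed

text \<open>
  For a trivial \<open>c\<close> the supremum dominates the distance of \<open>\<alpha> \<bar>\<tau>\<^sup>m(a)\<bar>\<close> to the integers.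
\<close>

lemma (in prim_subst) bounded_away_imp_nontrivial:
  assumes a: "a \<in> A" and \<epsilon>: "0 < \<epsilon>"
    and away: "\<forall>\<^sub>F m in sequentially. \<epsilon> \<le> dist_int (\<alpha> * real (length ((\<tau> ^^ m) [a])))"
    and c: "letter_coboundary A X c"
    and lim: "(\<lambda>m. SUP u\<in>language (subst_subshift A \<tau>).
      dist_int (c ((\<tau> ^^ (m - n)) u) - \<alpha> * real (length ((\<tau> ^^ m) u)))) \<longlonglongrightarrow> 0"
  shows "\<not> trivial_coboundary A c"
proof
  assume triv: "trivial_coboundary A c"
  let ?D = "\<lambda>m u. dist_int (c ((\<tau> ^^ (m - n)) u) - \<alpha> * real (length ((\<tau> ^^ m) u)))"
  have "?D m [a] \<le> (SUP u\<in>language (subst_subshift A \<tau>). ?D m u)" for m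
    by (rule cSUP_upper[OF factor_in_language[OF singleton_in_factors[OF a]]])
       (auto simp: bdd_above_def intro!: exI[of _ 1] dist_int_le_1)
  moreover have "?D m [a] = dist_int (\<alpha> * real (length ((\<tau> ^^ m) [a])))" for m
    using trivial_coboundary_vanishes[OF c triv] pow_lists[of "[a]"] a by (simp add: dist_int_minus)
  ultimately have "\<forall>\<^sub>F m in sequentially. \<epsilon> \<le> (SUP u\<in>language (subst_subshift A \<tau>). ?D m u)"
    using away by (auto elim!: eventually_mono intro: order_trans)
  then have "\<epsilon> \<le> 0"
    using lim by (intro tendsto_lowerbound[OF lim]) auto
  then show False using \<epsilon> by simp
qed

lemma adjacent_change:
  assumes "x \<in> set w" "P x" "y \<in> set w" "\<not> P y"
  shows "\<exists>b c. sublist [b, c] w \<and> P b \<noteq> P c"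
  using assms
proof (induction w arbitrary: x y)
  case (Cons a w)
  show ?case
  proof (cases "\<exists>x\<in>set w. P x \<noteq> P a")
    case True
    then obtain v where v: "v \<in> set w" "P v \<noteq> P a" by blast
    then obtain d w' where w: "w = d # w'" by (cases w) auto
    show ?thesis
    proof (cases "P d = P a")
      case True
      then obtain b c where "sublist [b, c] w" "P b \<noteq> P c"
        using Cons.IH[of v d] Cons.IH[of d v] v w by (cases "P v") auto
      then show ?thesis by (auto simp: sublist_Cons_right)
    next
      case False
      then show ?thesis
        by (intro exI[of _ a] exI[of _ d]) (auto simp: w sublist_Cons_right)
    qed
  next
    case False
    then show ?thesis using Cons.prems by auto
  qed
qed simp

context cut_shift
begin

text \<open>
  The letters fall into those whose orbit under \<open>cut_letter\<close> is absorbed by \<open>q\<close> and those whose orbit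
  avoids \<open>q\<close>; as \<open>q\<close> and \<open>p\<close> are fixed, both kinds exist. For a factor \<open>b c\<close> with letters of different
  kinds the two shifts eventually differ by exactly \<open>k\<close>, which moves \<open>\<alpha> \<bar>\<sigma>\<^sup>n(b c)\<bar>\<close> away from the integers.
\<close>

lemma sigma_bounded_away_of_shift:
  assumes q: "q \<in> A" "cut_letter q = q" and p: "p \<in> A" "cut_letter p = p" "p \<noteq> q"
    and s: "\<And>a. s a = (if a = q then k else 0)"
    and small: "\<And>u. u \<in> factors A \<tau> \<Longrightarrow> dist_int (\<alpha> * real (length (\<tau> u))) < \<delta>"
    and k: "2 * \<delta> \<le> dist_int (\<alpha> * real k)"
  shows "\<exists>i\<in>pairs. \<forall>\<^sub>F n in sequentially. \<delta> \<le> dist_int (\<alpha> * real (length ((sigma ^^ n) [i])))"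
proof -
  define P where "P = (\<lambda>b. \<exists>n. (cut_letter ^^ n) b = q)"
  have fixq: "(cut_letter ^^ n) q = q" and fixp: "(cut_letter ^^ n) p = p" for n
    using q(2) p(2) by (induction n) auto
  have "P q" "\<not> P p" using fixp p(3) by (auto simp: P_def intro: exI[of _ 0])
  obtain m where "p \<in> set ((\<tau> ^^ m) [p])" "q \<in> set ((\<tau> ^^ m) [p])"
    using all_letters_occur p(1) q(1) by blast
  then obtain b c where bc: "sublist [b, c] ((\<tau> ^^ m) [p])" "P b \<noteq> P c"
    using adjacent_change[where P = P] \<open>P q\<close> \<open>\<not> P p\<close> by metis
  have fac: "[b, c] \<in> factors A \<tau>"
    using sublist_in_factors[OF pow_in_factors[OF singleton_in_factors[OF p(1)]] bc(1)] .
  have absorbed: "\<forall>\<^sub>F n in sequentially. (cut_letter ^^ n) x = q" if x: "P x" for x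
  proof -
    obtain n0 where n0: "(cut_letter ^^ n0) x = q" using x by (auto simp: P_def)
    have "(cut_letter ^^ n) x = q" if "n \<ge> n0" for n
    proof -
      have "(cut_letter ^^ n) x = (cut_letter ^^ (n - n0)) ((cut_letter ^^ n0) x)"
        using that by (metis comp_apply funpow_add le_add_diff_inverse2)
      then show ?thesis by (simp add: n0 fixq)
    qed
    then show ?thesis by (auto simp: eventually_sequentially)
  qed
  have avoided: "(cut_letter ^^ n) x \<noteq> q" if "\<not> P x" for x n
    using that by (auto simp: P_def)
  have ev: "\<forall>\<^sub>F n in sequentially. dist_int (\<alpha> * real (s ((cut_letter ^^ n) c)) - \<alpha> * real (s ((cut_letter ^^ n) b))) =
      dist_int (\<alpha> * real k)"
  proof (cases "P b")
    case True
    then have "(cut_letter ^^ n) c \<noteq> q" for n using avoided bc(2) by simp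
    then show ?thesis
      by (intro eventually_mono[OF absorbed[OF True]]) (simp add: s dist_int_minus)
  next
    case False
    then have "P c" using bc(2) by simp
    show ?thesis
      by (intro eventually_mono[OF absorbed[OF \<open>P c\<close>]]) (simp add: s avoided[OF False])
  qed
  have "\<forall>\<^sub>F n in sequentially. \<delta> \<le> dist_int (\<alpha> * real (length ((sigma ^^ Suc n) [e (b, c)])))"
    using ev
  proof (rule eventually_mono)
    fix n
    let ?s = "\<lambda>x. real (s ((cut_letter ^^ n) x))"
    assume d: "dist_int (\<alpha> * ?s c - \<alpha> * ?s b) = dist_int (\<alpha> * real k)"
    obtain u where u: "u \<in> factors A \<tau>"
      "length ((sigma ^^ Suc n) [e (b, c)]) + s ((cut_letter ^^ n) b) = length (\<tau> u) + s ((cut_letter ^^ n) c)"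
      using length_sigma_pow_Suc[OF fac] by blast
    have "real (length ((sigma ^^ Suc n) [e (b, c)])) + ?s b = real (length (\<tau> u)) + ?s c"
      using arg_cong[OF u(2), of real] by (simp only: of_nat_add)
    then have "\<alpha> * real (length ((sigma ^^ Suc n) [e (b, c)])) + \<alpha> * ?s b =
        \<alpha> * real (length (\<tau> u)) + \<alpha> * ?s c"
      by (simp only: distrib_left[symmetric])
    then have "\<alpha> * ?s c - \<alpha> * ?s b =
        \<alpha> * real (length ((sigma ^^ Suc n) [e (b, c)])) - \<alpha> * real (length (\<tau> u))"
      by linarith
    then have "dist_int (\<alpha> * real k) \<le>
        dist_int (\<alpha> * real (length ((sigma ^^ Suc n) [e (b, c)]))) + dist_int (\<alpha> * real (length (\<tau> u)))"
      using dist_int_diff d by metis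
    then show "\<delta> \<le> dist_int (\<alpha> * real (length ((sigma ^^ Suc n) [e (b, c)])))"
      using small[OF u(1)] k by linarith
  qed
  then have "\<forall>\<^sub>F n in sequentially. \<delta> \<le> dist_int (\<alpha> * real (length ((sigma ^^ n) [e (b, c)])))"
    by (subst (asm) eventually_sequentially_Suc)
  moreover have "e (b, c) \<in> pairs" using fac by (auto simp: pairs_def)
  ultimately show ?thesis by blast
qed

end

context fixed_ends
begin

text \<open>
  All high powers of \<open>\<tau>\<close> at \<open>q\<close> share a prefix \<open>\<tau>\<^sup>m(r)\<close> with \<open>r\<close> the first letter of \<open>\<tau>(q)\<close>, and \<open>q\<close>
  occurs in it for large \<open>m\<close>. Looking for an occurrence of \<open>q\<close> that has a left neighbour ensures that
  its position is not 0, also when \<open>r = q\<close>.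
\<close>

lemma letter_at_stable_position:
  assumes q: "q \<in> A"
  obtains k N where "k \<ge> 1" "\<And>n. n \<ge> N \<Longrightarrow> k < length ((\<tau> ^^ n) [q]) \<and> (\<tau> ^^ n) [q] ! k = q"
proof -
  let ?r = "hd (\<tau> [q])"
  have r: "?r \<in> A" using hd_last_in_A[OF q, of 1] by simp
  obtain l r' where lr: "l # [q] @ [r'] \<in> factors A \<tau>"
    using factor_extends[OF singleton_in_factors[OF q]] by blast
  obtain m where "sublist (l # [q] @ [r']) ((\<tau> ^^ m) [?r])"
    using factor_in_all_large_powers[OF lr] r by blast
  then obtain x y where xy: "(\<tau> ^^ m) [?r] = x @ (l # [q] @ [r']) @ y" by (auto simp: sublist_def)
  have "length x + 1 < length ((\<tau> ^^ n) [q]) \<and> (\<tau> ^^ n) [q] ! (length x + 1) = q" if "n \<ge> m + 1" for n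
  proof -
    have "prefix ((\<tau> ^^ m) [?r]) ((\<tau> ^^ n) [q])"
      using stable_prefix[of "[q]" m n] q that by simp
    then show ?thesis by (auto simp: xy prefix_def nth_append)
  qed
  then show thesis using that[of "length x + 1" "m + 1"] by simp
qed

end

lemma (in prim_subst) conjugate_with_lengths_bounded_away:
  assumes ev: "eigenvalue A (subst_subshift A \<tau>) \<alpha>" and irr: "\<alpha> \<notin> \<rat>"
  shows "\<exists>(B :: nat set) \<sigma>. prim_subst B \<sigma> \<and>
    conjugate_subshifts B (subst_subshift B \<sigma>) A (subst_subshift A \<tau>) \<and>
    (\<exists>a\<in>B. \<exists>\<epsilon>>0. \<forall>\<^sub>F n in sequentially. \<epsilon> \<le> dist_int (\<alpha> * real (length ((\<sigma> ^^ n) [a]))))"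
proof -
  obtain N0 where N0: "N0 \<ge> 1" "fixed_ends A (\<tau> ^^ N0)" using some_power_fixed_ends by blast
  interpret F: fixed_ends A "\<tau> ^^ N0" by (rule N0(2))
  obtain e :: "'a \<times> 'a \<Rightarrow> nat" where e: "inj_on e (A \<times> A)"
    using finite_imp_inj_to_nat_seg[of "A \<times> A"] finA by blast
  have evF: "eigenvalue A (subst_subshift A (\<tau> ^^ N0)) \<alpha>"
    using ev subst_subshift_pow[OF N0(1)] by simp
  consider (away) "\<exists>a\<in>A. \<exists>\<epsilon>>0. \<forall>\<^sub>F n in sequentially.
      \<epsilon> \<le> dist_int (\<alpha> * real (length (((\<tau> ^^ N0) ^^ n) [a])))"
    | (null) "\<forall>\<epsilon>>0. \<exists>n0. \<forall>n\<ge>n0. \<forall>u\<in>factors A (\<tau> ^^ N0).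
      dist_int (\<alpha> * real (length (((\<tau> ^^ N0) ^^ n) u))) < \<epsilon>"
    using F.bounded_away_or_uniformly_null[OF evF] by blast
  then show ?thesis
  proof cases
    case away
    then obtain a \<epsilon> where a: "a \<in> A" "\<epsilon> > 0" "\<forall>\<^sub>F n in sequentially.
      \<epsilon> \<le> dist_int (\<alpha> * real (length (((\<tau> ^^ N0) ^^ n) [a])))" by blast
    obtain M where M: "M \<ge> 1" "\<And>b. b \<in> A \<Longrightarrow> 2 \<le> length (((\<tau> ^^ N0) ^^ M) [b])"
      using F.lengths_unbounded[of 2] by (meson le_add1 le_add2)
    let ?T = "(\<tau> ^^ N0) ^^ M"
    interpret T: prim_subst A ?T by (rule F.prim_subst_pow[OF M(1)])
    interpret C: cut_shift A ?T "\<lambda>_. 0" e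
      by unfold_locales (use e M(2) in \<open>auto simp: numeral_2_eq_2\<close>)
    \<comment> \<open>Without shifts, \<open>\<sigma>\<^sup>n\<close> of a block \<open>a c\<close> is as long as the unshifted image of \<open>a\<close>.\<close>
    obtain c where c: "[a, c] \<in> factors A ?T" using C.letter_pair[OF a(1)] by blast
    have "filterlim (\<lambda>n. M * n) sequentially sequentially"
      using M(1) by (intro mult_nat_left_at_top) simp
    then have "\<forall>\<^sub>F n in sequentially. \<epsilon> \<le> dist_int (\<alpha> * real (length (((\<tau> ^^ N0) ^^ (M * n)) [a])))"
      using a(3) by (rule eventually_compose_filterlim[rotated])
    then have "\<forall>\<^sub>F n in sequentially. \<epsilon> \<le> dist_int (\<alpha> * real (length ((C.sigma ^^ n) [e (a, c)])))"
      unfolding C.length_sigma_pow_no_shift[OF c refl] by (simp only: funpow_mult[where f = "\<tau> ^^ N0" and m = M])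
    moreover have "e (a, c) \<in> C.pairs" using c by (auto simp: C.pairs_def)
    ultimately show ?thesis
      using C.prim_subst_sigma C.conjugate_sigma a(2) F.subst_subshift_pow[OF M(1)] subst_subshift_pow[OF N0(1)]
      by metis
  next
    case null
    obtain a0 where a0: "a0 \<in> A" using A_nonempty by blast
    define p where "p = hd ((\<tau> ^^ N0) [a0])"
    have p: "p \<in> A" "hd ((\<tau> ^^ N0) [p]) = p"
      using F.hd_fixed[OF a0] hd_last_in_A[OF a0] by (auto simp: p_def)
    obtain q where q: "q \<in> A" "q \<noteq> p"
      using card_A p(1) by (metis card_le_Suc0_iff_eq finA not_less_eq_eq numeral_2_eq_2)
    obtain k n1 where k: "k \<ge> 1"
      "\<And>n. n \<ge> n1 \<Longrightarrow> k < length (((\<tau> ^^ N0) ^^ n) [q]) \<and> ((\<tau> ^^ N0) ^^ n) [q] ! k = q"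
      using F.letter_at_stable_position[OF q(1)] by metis
    have "\<alpha> * real k \<notin> \<int>"
    proof
      assume "\<alpha> * real k \<in> \<int>"
      then have "\<alpha> * real k / real k \<in> \<rat>"
        using Ints_subset_Rats by (intro Rats_divide) auto
      then show False using irr k(1) by simp
    qed
    then have pos: "0 < dist_int (\<alpha> * real k)" by (rule dist_int_pos)
    define \<delta> where "\<delta> = dist_int (\<alpha> * real k) / 2"
    obtain n2 where n2: "\<And>n u. n \<ge> n2 \<Longrightarrow> u \<in> factors A (\<tau> ^^ N0) \<Longrightarrow>
        dist_int (\<alpha> * real (length (((\<tau> ^^ N0) ^^ n) u))) < \<delta>"
      using null pos by (metis \<delta>_def half_gt_zero)
    obtain n3 where n3: "\<And>n b. n \<ge> n3 \<Longrightarrow> b \<in> A \<Longrightarrow> k + 2 \<le> length (((\<tau> ^^ N0) ^^ n) [b])"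
      using F.lengths_unbounded by blast
    \<comment> \<open>Only now is the power chosen: \<open>k\<close>, and with it the tolerance \<open>\<delta>\<close>, must not depend on it.\<close>
    define M where "M = n1 + n2 + n3 + 1"
    have M: "M \<ge> 1" "M \<ge> n1" "M \<ge> n2" "M \<ge> n3" by (auto simp: M_def)
    let ?T = "(\<tau> ^^ N0) ^^ M" and ?s = "\<lambda>b. if b = q then k else 0"
    interpret T: prim_subst A ?T by (rule F.prim_subst_pow[OF M(1)])
    interpret C: cut_shift A ?T ?s e
      by unfold_locales (use e n3[OF M(4)] in force)+
    have "C.cut_letter q = q" using k(2)[OF M(2)] by (simp add: C.cut_letter_def)
    moreover have "C.cut_letter p = p"
      using F.hd_last_pow(1)[OF p(1) M(1)] p q(2) T.pow_letter_neq_Nil[OF p(1), of 1]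
      by (simp add: C.cut_letter_def hd_conv_nth)
    ultimately have "\<exists>i\<in>C.pairs. \<forall>\<^sub>F n in sequentially. \<delta> \<le> dist_int (\<alpha> * real (length ((C.sigma ^^ n) [i])))"
    proof (intro C.sigma_bounded_away_of_shift[of q p k])
      fix u assume "u \<in> factors A ?T"
      then show "dist_int (\<alpha> * real (length (?T u))) < \<delta>"
        using n2[OF M(3)] F.factors_pow[OF M(1)] by simp
    qed (use p q in \<open>auto simp: \<delta>_def\<close>)
    moreover have "0 < \<delta>" using pos by (simp add: \<delta>_def)
    ultimately show ?thesis
      using C.prim_subst_sigma C.conjugate_sigma F.subst_subshift_pow[OF M(1)] subst_subshift_pow[OF N0(1)]
      by metis
  qed
qed

theorem proposition9p3:
  fixes A :: "'a set" and \<tau> :: "'a list \<Rightarrow> 'a list" and \<alpha> :: real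
  assumes "primitive_substitution A \<tau>"
    and "eigenvalue A (subst_subshift A \<tau>) \<alpha>"
    and "\<alpha> \<notin> \<rat>"
  shows "\<exists>(B :: nat set) (\<sigma> :: nat list \<Rightarrow> nat list).
    primitive_substitution B \<sigma> \<and>
    conjugate_subshifts B (subst_subshift B \<sigma>) A (subst_subshift A \<tau>) \<and>
    (\<exists>a\<in>B. \<exists>\<epsilon>>0. \<forall>\<^sub>F n in sequentially. \<epsilon> \<le> dist_int (\<alpha> * real (length ((\<sigma> ^^ n) [a])))) \<and>
    (\<forall>(n :: nat) c. letter_coboundary B (subst_subshift B \<sigma>) c \<longrightarrow>
       ((\<lambda>m. SUP u\<in>language (subst_subshift B \<sigma>).
            dist_int (c ((\<sigma> ^^ (m - n)) u) - \<alpha> * real (length ((\<sigma> ^^ m) u)))) \<longlonglongrightarrow> 0) \<longrightarrow>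
       \<not> trivial_coboundary B c)"
proof -
  interpret prim_subst A \<tau> by unfold_locales (rule assms(1))
  obtain B :: "nat set" and \<sigma> where B: "prim_subst B \<sigma>"
    "conjugate_subshifts B (subst_subshift B \<sigma>) A (subst_subshift A \<tau>)"
    "\<exists>a\<in>B. \<exists>\<epsilon>>0. \<forall>\<^sub>F n in sequentially. \<epsilon> \<le> dist_int (\<alpha> * real (length ((\<sigma> ^^ n) [a])))"
    using conjugate_with_lengths_bounded_away[OF assms(2,3)] by blast
  interpret S: prim_subst B \<sigma> by (rule B(1))
  show ?thesis
    using S.prim B(2,3) S.bounded_away_imp_nontrivial by blast
qed

end
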